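(* Let $p$ be an odd prime, let $\Gamma_{(p)}$ be the Gupta-Sidki $p$-group, acting on the $p$-ary rooted tree, and for $n\geq 1$ let $\operatorname{Stab}_{\Gamma_{(p)}}(n)$ be its $n$th level stabiliser. Set $C_p = 3\cdot 4^p - 2^p(p+8)+7$. Then $$\operatorname{diam}\big(\Gamma_{(p)}/\operatorname{Stab}_{\Gamma_{(p)}}(n)\big) = O_p\big(\exp(\log(C_p)\,n)\big)$$ and $$\operatorname{diam}\big(\Gamma_{(p)}/\operatorname{Stab}_{\Gamma_{(p)}}(n)\big) = O_p\Big(\big(\log|\Gamma_{(p)}:\operatorname{Stab}_{\Gamma_{(p)}}(n)|\big)^{\log(C_p)/\log(p)}\Big),$$ where the implied constants depend only on $p$ (not on $n$).
   Context: Diameter: for a finite group $G$ and a generating set $S\subseteq G$, $B_S(n)$ is the closed ball of radius $n$ about the identity in the word metric of $S$, i.e. the set of products of at most $n$ elements of $S\cup S^{-1}$; $\operatorname{diam}(G,S)=\min\{n\in\mathbb{N}: B_S(n)=G\}$; and $\operatorname{diam}(G)$ is the maximum of $\operatorname{diam}(G,S)$ over all generating sets $S$ of $G$. Tree: let $\mathcal{A}=\{0,1,\ldots,p-1\}$ and let $\mathcal{A}^*$ be the set of finite words over $\mathcal{A}$, viewed as the vertex set of the $p$-ary rooted tree $\mathcal{T}_p$ (root the empty word; each word $v$ is joined to $vi$, $i\in\mathcal{A}$). $\operatorname{Aut}(\mathcal{T}_p)$ is the group of permutations of $\mathcal{A}^*$ preserving the prefix relation. $\operatorname{Stab}(n)$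 is the kernel of its action on the set $\mathcal{A}^n$ of words of length $n$, and $\operatorname{Stab}_\Gamma(n)=\Gamma\cap\operatorname{Stab}(n)$ for $\Gamma\leq\operatorname{Aut}(\mathcal{T}_p)$. An element $\phi\in\operatorname{Stab}(1)$ is identified with the tuple $(\phi_0,\ldots,\phi_{p-1})\in\operatorname{Aut}(\mathcal{T}_p)^p$ such that $\phi(iw)=i\,\phi_i(w)$ for all $i\in\mathcal{A}$, $w\in\mathcal{A}^*$. The Gupta-Sidki $p$-group $\Gamma_{(p)}$ is the subgroup of $\operatorname{Aut}(\mathcal{T}_p)$ generated by $a$ and $b$, where $a(iw)=(i+1)w$ for $0\leq i\leq p-2$ and $a((p-1)w)=0w$, and $b\in\operatorname{Stab}(1)$ is defined recursively by $b=(a,a^{-1},1,\ldots,1,b)$. *)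

theory Defs
  imports
    Complex_Main
    "HOL-Library.Sublist"
    "HOL-Computational_Algebra.Primes"
    "HOL-Algebra.Bij"
    "HOL-Algebra.Coset"
    "HOL-Algebra.Generated_Groups"
begin

section \<open>Diameters of finite groups\<close>

definition word_ball :: "('a, 'm) monoid_scheme \<Rightarrow> 'a set \<Rightarrow> nat \<Rightarrow> 'a set" where
  "word_ball G S n =
    {foldr (\<otimes>\<^bsub>G\<^esub>) xs \<one>\<^bsub>G\<^esub> | xs. set xs \<subseteq> S \<union> set_inv\<^bsub>G\<^esub> S \<and> length xs \<le> n}"

definition diam_wrt :: "('a, 'm) monoid_scheme \<Rightarrow> 'a set \<Rightarrow> nat" where
  "diam_wrt G S = (LEAST n. word_ball G S n = carrier G)"

text \<open>Meaningful for finite \<open>G\<close> only: there the maximum is over a finite nonempty set, and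
  every \<^const>\<open>diam_wrt\<close> in it is attained (see \<open>ex_word_ball_eq_carrier\<close> below).\<close>

definition diam :: "('a, 'm) monoid_scheme \<Rightarrow> nat" where
  "diam G = Max {diam_wrt G S | S. S \<subseteq> carrier G \<and> generate G S = carrier G}"

section \<open>The rooted tree and its automorphisms\<close>

definition tree_words :: "nat \<Rightarrow> nat list set" where
  "tree_words p = lists {..<p}"

definition level_words :: "nat \<Rightarrow> nat \<Rightarrow> nat list set" where
  "level_words p n = {w \<in> tree_words p. length w = n}"

text \<open>As in \<^const>\<open>BijGroup\<close>, elements are extensional functions and the product is
  composition, the right factor acting first.\<close>

definition tree_aut :: "nat \<Rightarrow> (nat list \<Rightarrow> nat list) monoid" where
  "tree_aut p = (BijGroup (tree_words p))
    \<lparr>carrier := {f \<in> Bij (tree_words p).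
       \<forall>v\<in>tree_words p. \<forall>w\<in>tree_words p. prefix (f v) (f w) \<longleftrightarrow> prefix v w}\<rparr>"

definition level_stab :: "nat \<Rightarrow> nat \<Rightarrow> (nat list \<Rightarrow> nat list) set" where
  "level_stab p n =
    kernel (tree_aut p) (BijGroup (level_words p n)) (\<lambda>f. restrict f (level_words p n))"

text \<open>The component \<open>\<phi>\<^sub>i\<close> of an element \<open>\<phi>\<close> of the first level stabiliser.\<close>

definition tree_component :: "nat \<Rightarrow> (nat list \<Rightarrow> nat list) \<Rightarrow> nat \<Rightarrow> nat list \<Rightarrow> nat list" where
  "tree_component p \<phi> i = (\<lambda>w\<in>tree_words p. tl (\<phi> (i # w)))"

section \<open>The Gupta-Sidki group\<close>

fun gs_a_word :: "nat \<Rightarrow> nat list \<Rightarrow> nat list" where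
  "gs_a_word p [] = []"
| "gs_a_word p (i # w) = (if i = p - 1 then 0 else i + 1) # w"

definition gs_a :: "nat \<Rightarrow> nat list \<Rightarrow> nat list" where
  "gs_a p = (\<lambda>w\<in>tree_words p. gs_a_word p w)"

fun gs_b_word :: "nat \<Rightarrow> nat list \<Rightarrow> nat list" where
  "gs_b_word p [] = []"
| "gs_b_word p (i # w) = i #
     (if i = 0 then gs_a p w
      else if i = 1 then (inv\<^bsub>tree_aut p\<^esub> gs_a p) w
      else if i = p - 1 then gs_b_word p w
      else w)"

definition gs_b :: "nat \<Rightarrow> nat list \<Rightarrow> nat list" where
  "gs_b p = (\<lambda>w\<in>tree_words p. gs_b_word p w)"

definition gupta_sidki :: "nat \<Rightarrow> (nat list \<Rightarrow> nat list) monoid" where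
  "gupta_sidki p = (tree_aut p)\<lparr>carrier := generate (tree_aut p) {gs_a p, gs_b p}\<rparr>"

definition gs_stab :: "nat \<Rightarrow> nat \<Rightarrow> (nat list \<Rightarrow> nat list) set" where
  "gs_stab p n = carrier (gupta_sidki p) \<inter> level_stab p n"

definition gs_const :: "nat \<Rightarrow> real" where
  "gs_const p = 3 * 4 ^ p - 2 ^ p * (real p + 8) + 7"

section \<open>Consistency of the definitions\<close>

lemma foldr_mult_append:
  assumes "group G" "set xs \<subseteq> carrier G" "set ys \<subseteq> carrier G"
  shows "foldr (\<otimes>\<^bsub>G\<^esub>) (xs @ ys) \<one>\<^bsub>G\<^esub>
    = foldr (\<otimes>\<^bsub>G\<^esub>) xs \<one>\<^bsub>G\<^esub> \<otimes>\<^bsub>G\<^esub> foldr (\<otimes>\<^bsub>G\<^esub>) ys \<one>\<^bsub>G\<^esub>"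
proof -
  interpret group G by fact
  have cl: "foldr (\<otimes>\<^bsub>G\<^esub>) zs \<one>\<^bsub>G\<^esub> \<in> carrier G" if "set zs \<subseteq> carrier G" for zs
    using that by (induction zs) auto
  show ?thesis
    using assms(2) cl assms(3) by (induction xs) (auto simp: m_assoc)
qed

lemma ex_word_ball_eq_carrier:
  assumes G: "group G" and fin: "finite (carrier G)"
    and S: "S \<subseteq> carrier G" and gen: "generate G S = carrier G"
  shows "\<exists>n. word_ball G S n = carrier G"
proof -
  interpret group G by fact
  let ?T = "S \<union> set_inv\<^bsub>G\<^esub> S"
  let ?f = "\<lambda>xs. foldr (\<otimes>\<^bsub>G\<^esub>) xs \<one>\<^bsub>G\<^esub>"
  have T: "?T \<subseteq> carrier G" using S by (auto simp: SET_INV_def)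
  have cl: "?f zs \<in> carrier G" if "set zs \<subseteq> carrier G" for zs
    using that by (induction zs) auto
  have "\<exists>xs. set xs \<subseteq> ?T \<and> ?f xs = g" if "g \<in> generate G S" for g
    using that
  proof (induction rule: generate.induct)
    case one
    show ?case by (rule exI[of _ "[]"]) auto
  next
    case (incl h)
    then show ?case using S by (intro exI[of _ "[h]"]) auto
  next
    case (inv h)
    then show ?case using S by (intro exI[of _ "[inv\<^bsub>G\<^esub> h]"]) (auto simp: SET_INV_def)
  next
    case (eng h1 h2)
    then obtain xs ys where "set xs \<subseteq> ?T" "?f xs = h1" "set ys \<subseteq> ?T" "?f ys = h2" by blast
    then show ?case using T foldr_mult_append[OF G, of xs ys]
      by (intro exI[of _ "xs @ ys"]) auto
  qed
  then obtain w where w: "\<And>g. g \<in> carrier G \<Longrightarrow> set (w g) \<subseteq> ?T \<and> ?f (w g) = g"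
    unfolding gen by metis
  let ?n = "Max ((length \<circ> w) ` carrier G)"
  have "word_ball G S ?n = carrier G"
  proof
    show "word_ball G S ?n \<subseteq> carrier G"
      using T cl unfolding word_ball_def by fast
    show "carrier G \<subseteq> word_ball G S ?n"
    proof
      fix g assume g: "g \<in> carrier G"
      then have "length (w g) \<le> ?n" using fin by (intro Max_ge) auto
      then show "g \<in> word_ball G S ?n" using w[OF g] unfolding word_ball_def by force
    qed
  qed
  then show ?thesis by blast
qed

lemma tree_words_Nil [simp]: "[] \<in> tree_words p"
  and tree_words_Cons [simp]: "i # w \<in> tree_words p \<longleftrightarrow> i < p \<and> w \<in> tree_words p"
  by (auto simp: tree_words_def)

lemma subgroup_tree_aut: "subgroup (carrier (tree_aut p)) (BijGroup (tree_words p))"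
proof -
  interpret B: group "BijGroup (tree_words p)" by (rule group_BijGroup)
  show ?thesis
  proof (rule B.subgroupI)
    show "carrier (tree_aut p) \<subseteq> carrier (BijGroup (tree_words p))"
      by (auto simp: tree_aut_def BijGroup_def)
    have "\<one>\<^bsub>BijGroup (tree_words p)\<^esub> \<in> carrier (tree_aut p)"
      using id_Bij by (auto simp: tree_aut_def BijGroup_def)
    then show "carrier (tree_aut p) \<noteq> {}" by blast
  next
    fix f assume f: "f \<in> carrier (tree_aut p)"
    then have fB: "f \<in> Bij (tree_words p)" by (auto simp: tree_aut_def)
    let ?g = "\<lambda>x\<in>tree_words p. inv_into (tree_words p) f x"
    have eq: "inv\<^bsub>BijGroup (tree_words p)\<^esub> f = ?g"
      using fB by (rule inv_BijGroup)
    have mem: "inv_into (tree_words p) f v \<in> tree_words p"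
      and fi: "f (inv_into (tree_words p) f v) = v" if "v \<in> tree_words p" for v
      using fB that by (auto simp: Bij_def bij_betw_def inv_into_into f_inv_into_f)
    have "prefix (?g v) (?g w) \<longleftrightarrow> prefix v w" if "v \<in> tree_words p" "w \<in> tree_words p" for v w
    proof -
      have "prefix (f (?g v)) (f (?g w)) \<longleftrightarrow> prefix (?g v) (?g w)"
        using f mem that by (simp add: tree_aut_def)
      then show ?thesis using fi that by simp
    qed
    then show "inv\<^bsub>BijGroup (tree_words p)\<^esub> f \<in> carrier (tree_aut p)"
      unfolding eq using restrict_inv_into_Bij[OF fB] by (simp add: tree_aut_def)
  next
    fix f g assume fg: "f \<in> carrier (tree_aut p)" "g \<in> carrier (tree_aut p)"
    then have B: "f \<in> Bij (tree_words p)" "g \<in> Bij (tree_words p)" by (auto simp: tree_aut_def)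
    have "g v \<in> tree_words p" if "v \<in> tree_words p" for v
      using Bij_imp_funcset[OF B(2)] that by auto
    then show "f \<otimes>\<^bsub>BijGroup (tree_words p)\<^esub> g \<in> carrier (tree_aut p)"
      using fg B compose_Bij[OF B] by (simp add: tree_aut_def BijGroup_def compose_def)
  qed
qed

lemma group_tree_aut: "group (tree_aut p)"
proof -
  interpret B: group "BijGroup (tree_words p)" by (rule group_BijGroup)
  have "tree_aut p = (BijGroup (tree_words p))\<lparr>carrier := carrier (tree_aut p)\<rparr>"
    by (simp add: tree_aut_def)
  then show ?thesis
    using B.subgroup_imp_group[OF subgroup_tree_aut] by metis
qed

lemma tree_aut_length:
  assumes f: "f \<in> carrier (tree_aut p)" and w: "w \<in> tree_words p"
  shows "length (f w) = length w"
proof -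
  have B: "bij_betw f (tree_words p) (tree_words p)" using f by (auto simp: tree_aut_def Bij_def)
  have pc: "u \<in> tree_words p" if "prefix u v" "v \<in> tree_words p" for u v
    using that by (auto simp: tree_words_def prefix_def)
  have fw: "f w \<in> tree_words p" using B w by (rule bij_betw_apply)
  have "f ` {u. prefix u w} = {u. prefix u (f w)}"
  proof
    show "f ` {u. prefix u w} \<subseteq> {u. prefix u (f w)}"
      using f w pc by (auto simp: tree_aut_def)
    show "{u. prefix u (f w)} \<subseteq> f ` {u. prefix u w}"
    proof
      fix u assume u: "u \<in> {u. prefix u (f w)}"
      then have "u \<in> tree_words p" using pc fw by blast
      then obtain v where v: "v \<in> tree_words p" "u = f v" using B by (auto simp: bij_betw_def)
      then show "u \<in> f ` {u. prefix u w}" using u f w by (auto simp: tree_aut_def)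
    qed
  qed
  moreover have "inj_on f {u. prefix u w}"
    using B pc w by (auto simp: bij_betw_def intro: inj_on_subset)
  ultimately have "card {u. prefix u w} = card {u. prefix u (f w)}" by (metis card_image)
  moreover have "card {u. prefix u v} = Suc (length v)" for v :: "nat list"
  proof -
    have "{u. prefix u v} = set (prefixes v)" by auto
    then show ?thesis by (simp add: distinct_card)
  qed
  ultimately show ?thesis by simp
qed

lemma tree_aut_level:
  assumes f: "f \<in> carrier (tree_aut p)"
  shows "restrict f (level_words p n) \<in> Bij (level_words p n)"
proof -
  have B: "bij_betw f (tree_words p) (tree_words p)" using f by (auto simp: tree_aut_def Bij_def)
  have "f ` level_words p n = level_words p n"
  proof
    show "f ` level_words p n \<subseteq> level_words p n"
      using f B tree_aut_length by (auto simp: level_words_def bij_betw_apply)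
    show "level_words p n \<subseteq> f ` level_words p n"
    proof
      fix w assume w: "w \<in> level_words p n"
      then have "w \<in> f ` tree_words p"
        using bij_betw_imp_surj_on[OF B] by (simp add: level_words_def)
      then obtain v where v: "v \<in> tree_words p" "w = f v" by (rule imageE)
      then have "v \<in> level_words p n"
        using w tree_aut_length[OF f v(1)] by (simp add: level_words_def)
      then show "w \<in> f ` level_words p n" using v by simp
    qed
  qed
  moreover have "inj_on f (level_words p n)"
    using B by (auto simp: bij_betw_def level_words_def intro: inj_on_subset)
  ultimately show ?thesis by (simp add: Bij_def bij_betw_def)
qed

lemma group_hom_level:
  "group_hom (tree_aut p) (BijGroup (level_words p n)) (\<lambda>f. restrict f (level_words p n))"
proof -
  have "(\<lambda>f. restrict f (level_words p n)) \<in> hom (tree_aut p) (BijGroup (level_words p n))"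
  proof (rule homI)
    fix f assume "f \<in> carrier (tree_aut p)"
    then show "restrict f (level_words p n) \<in> carrier (BijGroup (level_words p n))"
      using tree_aut_level by (simp add: BijGroup_def)
  next
    fix f g assume fg: "f \<in> carrier (tree_aut p)" "g \<in> carrier (tree_aut p)"
    then have B: "f \<in> Bij (tree_words p)" "g \<in> Bij (tree_words p)" by (auto simp: tree_aut_def)
    have "g v \<in> level_words p n" if "v \<in> level_words p n" for v
      using Bij_imp_funcset[OF tree_aut_level[OF fg(2)]] that by force
    then show "restrict (f \<otimes>\<^bsub>tree_aut p\<^esub> g) (level_words p n)
        = restrict f (level_words p n) \<otimes>\<^bsub>BijGroup (level_words p n)\<^esub> restrict g (level_words p n)"
      using B tree_aut_level[OF fg(1), of n] tree_aut_level[OF fg(2), of n]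
      by (auto simp: tree_aut_def BijGroup_def compose_def level_words_def fun_eq_iff)
  qed
  then show ?thesis
    by (simp add: group_hom_def group_hom_axioms_def group_tree_aut group_BijGroup)
qed

lemma gs_a_in_tree_aut:
  assumes "p > 0"
  shows "gs_a p \<in> carrier (tree_aut p)"
proof -
  let ?s = "\<lambda>i. if i = p - 1 then 0 else i + 1"
  have inj: "?s i = ?s j \<Longrightarrow> i = j" for i j by (auto split: if_splits)
  have mem: "gs_a_word p w \<in> tree_words p" if "w \<in> tree_words p" for w
    using that assms by (cases w) auto
  have pre: "prefix (gs_a_word p v) (gs_a_word p w) \<longleftrightarrow> prefix v w" for v w
    by (cases v; cases w) (auto split: if_splits)
  have "bij_betw (gs_a_word p) (tree_words p) (tree_words p)"
  proof (rule bij_betw_imageI)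
    show "inj_on (gs_a_word p) (tree_words p)"
      by (rule inj_onI) (metis pre prefix_order.antisym prefix_order.refl)
    have "w \<in> gs_a_word p ` tree_words p" if "w \<in> tree_words p" for w
    proof (cases w)
      case Nil
      then show ?thesis by (intro image_eqI[of _ _ "[]"]) auto
    next
      case (Cons i u)
      then show ?thesis using that assms
        by (intro image_eqI[of _ _ "(if i = 0 then p - 1 else i - 1) # u"]) auto
    qed
    then show "gs_a_word p ` tree_words p = tree_words p" using mem by auto
  qed
  then show ?thesis
    using pre by (auto simp: tree_aut_def gs_a_def Bij_def)
qed

lemma gs_b_in_tree_aut:
  assumes "p > 0"
  shows "gs_b p \<in> carrier (tree_aut p)"
proof -
  interpret A: group "tree_aut p" by (rule group_tree_aut)
  let ?A = "gs_a p" and ?I = "inv\<^bsub>tree_aut p\<^esub> gs_a p"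
  have I: "?I \<in> carrier (tree_aut p)" using gs_a_in_tree_aut[OF assms] by simp
  note AI = gs_a_in_tree_aut[OF assms] I
  have bij: "bij_betw f (tree_words p) (tree_words p)" if "f \<in> carrier (tree_aut p)" for f
    using that by (auto simp: tree_aut_def Bij_def)
  have cpre: "prefix (f v) (f w) \<longleftrightarrow> prefix v w"
    if "f \<in> carrier (tree_aut p)" "v \<in> tree_words p" "w \<in> tree_words p" for f v w
    using that by (auto simp: tree_aut_def)
  have mem: "w \<in> tree_words p \<Longrightarrow> gs_b_word p w \<in> tree_words p" for w
    using bij_betw_apply[OF bij[OF AI(1)]] bij_betw_apply[OF bij[OF AI(2)]]
    by (induction w) auto
  have pre: "v \<in> tree_words p \<Longrightarrow> w \<in> tree_words p \<Longrightarrow>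
      prefix (gs_b_word p v) (gs_b_word p w) \<longleftrightarrow> prefix v w" for v w
  proof (induction v arbitrary: w)
    case (Cons i v)
    then show ?case using cpre[OF AI(1)] cpre[OF AI(2)] by (cases w) auto
  qed auto
  have surj: "w \<in> tree_words p \<Longrightarrow> \<exists>v\<in>tree_words p. gs_b_word p v = w" for w
  proof (induction w)
    case Nil
    show ?case by (rule bexI[of _ "[]"]) auto
  next
    case (Cons i w)
    obtain u where u: "u \<in> tree_words p" "gs_b_word p u = w" using Cons by auto
    obtain u1 where u1: "u1 \<in> tree_words p" "?A u1 = w"
      using bij[OF AI(1)] Cons unfolding bij_betw_def by (metis imageE tree_words_Cons)
    obtain u2 where u2: "u2 \<in> tree_words p" "?I u2 = w"
      using bij[OF AI(2)] Cons unfolding bij_betw_def by (metis imageE tree_words_Cons)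
    let ?v = "i # (if i = 0 then u1 else if i = 1 then u2 else if i = p - 1 then u else w)"
    have "?v \<in> tree_words p" "gs_b_word p ?v = i # w" using u u1 u2 Cons by auto
    then show ?case by blast
  qed
  have "bij_betw (gs_b_word p) (tree_words p) (tree_words p)"
  proof (rule bij_betw_imageI)
    show "inj_on (gs_b_word p) (tree_words p)"
      by (rule inj_onI) (metis pre prefix_order.antisym prefix_order.refl)
    show "gs_b_word p ` tree_words p = tree_words p" using mem surj by force
  qed
  then show ?thesis
    using pre by (auto simp: tree_aut_def gs_b_def Bij_def)
qed

lemma gs_b_in_level_stab:
  assumes "p > 0"
  shows "gs_b p \<in> level_stab p 1"
proof -
  have "w \<in> level_words p 1 \<Longrightarrow> gs_b p w = w" for w
  proof -
    interpret A: group "tree_aut p" by (rule group_tree_aut)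
    assume "w \<in> level_words p 1"
    then obtain i where w: "w = [i]" "i < p" by (auto simp: level_words_def length_Suc_conv)
    have "gs_b p w \<in> tree_words p" "length (gs_b p w) = 1"
      using gs_b_in_tree_aut[OF assms] tree_aut_length[of "gs_b p" p w] w
      by (auto simp: tree_aut_def Bij_def bij_betw_apply)
    then show "gs_b p w = w" using w by (auto simp: gs_b_def length_Suc_conv)
  qed
  then show ?thesis using gs_b_in_tree_aut[OF assms]
    by (auto simp: level_stab_def kernel_def BijGroup_def fun_eq_iff)
qed

text \<open>The recursion \<open>b = (a, a\<^sup>-\<^sup>1, 1, \<dots>, 1, b)\<close>.\<close>

lemma gs_b_components:
  assumes "p \<ge> 3" "i < p"
  shows "tree_component p (gs_b p) i =
    (if i = 0 then gs_a p
     else if i = 1 then inv\<^bsub>tree_aut p\<^esub> gs_a p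
     else if i = p - 1 then gs_b p
     else \<one>\<^bsub>tree_aut p\<^esub>)"
proof -
  interpret A: group "tree_aut p" by (rule group_tree_aut)
  have ext: "f \<in> extensional (tree_words p)" if "f \<in> carrier (tree_aut p)" for f
    using that by (auto simp: tree_aut_def Bij_def)
  have a: "gs_a p \<in> carrier (tree_aut p)" using assms gs_a_in_tree_aut by simp
  have one: "\<one>\<^bsub>tree_aut p\<^esub> = (\<lambda>w\<in>tree_words p. w)" by (simp add: tree_aut_def BijGroup_def)
  show ?thesis
    using assms(2) ext[OF a] ext[OF A.inv_closed[OF a]]
    unfolding one by (auto simp: tree_component_def gs_b_def extensional_def fun_eq_iff)
qed

lemma subgroup_gupta_sidki:
  assumes "p > 0"
  shows "subgroup (carrier (gupta_sidki p)) (tree_aut p)"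
proof -
  interpret A: group "tree_aut p" by (rule group_tree_aut)
  show ?thesis
    using A.generate_is_subgroup[of "{gs_a p, gs_b p}"] gs_a_in_tree_aut[OF assms]
      gs_b_in_tree_aut[OF assms] by (simp add: gupta_sidki_def)
qed

lemma group_gupta_sidki: "p > 0 \<Longrightarrow> group (gupta_sidki p)"
  using group.subgroup_imp_group[OF group_tree_aut subgroup_gupta_sidki]
  by (simp add: gupta_sidki_def)

lemma group_hom_gupta_sidki_level:
  assumes "p > 0"
  shows "group_hom (gupta_sidki p) (BijGroup (level_words p n)) (\<lambda>f. restrict f (level_words p n))"
proof -
  have sub: "carrier (gupta_sidki p) \<subseteq> carrier (tree_aut p)"
    using subgroup.subset[OF subgroup_gupta_sidki[OF assms]] .
  have m: "(\<otimes>\<^bsub>gupta_sidki p\<^esub>) = (\<otimes>\<^bsub>tree_aut p\<^esub>)" by (simp add: gupta_sidki_def)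
  have "(\<lambda>f. restrict f (level_words p n)) \<in> hom (tree_aut p) (BijGroup (level_words p n))"
    using group_hom.homh[OF group_hom_level] .
  then have "(\<lambda>f. restrict f (level_words p n)) \<in> hom (gupta_sidki p) (BijGroup (level_words p n))"
    using sub unfolding hom_def m by blast
  then show ?thesis
    by (simp add: group_hom_def group_hom_axioms_def group_gupta_sidki[OF assms] group_BijGroup)
qed

lemma gs_stab_eq_kernel:
  assumes "p > 0"
  shows "gs_stab p n =
    kernel (gupta_sidki p) (BijGroup (level_words p n)) (\<lambda>f. restrict f (level_words p n))"
  using subgroup.subset[OF subgroup_gupta_sidki[OF assms]]
  by (auto simp: gs_stab_def level_stab_def kernel_def)

lemma normal_gs_stab: "p > 0 \<Longrightarrow> gs_stab p n \<lhd> gupta_sidki p"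
  using group_hom.normal_kernel[OF group_hom_gupta_sidki_level] gs_stab_eq_kernel by simp

lemma finite_quotient_gs_stab:
  assumes "p > 0"
  shows "finite (carrier (gupta_sidki p Mod gs_stab p n))"
proof -
  let ?L = "level_words p n"
  interpret h: group_hom "gupta_sidki p" "BijGroup ?L" "\<lambda>f. restrict f ?L"
    by (rule group_hom_gupta_sidki_level[OF assms])
  have finL: "finite ?L"
    using finite_lists_length_eq[of "{..<p}" n]
    by (simp add: level_words_def tree_words_def lists_eq_set)
  have "Bij ?L \<subseteq> ?L \<rightarrow>\<^sub>E ?L"
    using Bij_imp_funcset Bij_imp_extensional unfolding PiE_def by blast
  then have "finite (Bij ?L)"
    using finL finite_PiE[of ?L "\<lambda>_. ?L"] finite_subset by blast
  then have "finite (carrier (BijGroup ?L))" by (simp add: BijGroup_def)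
  moreover have "(\<lambda>X. the_elem ((\<lambda>f. restrict f ?L) ` X)) `
      carrier (gupta_sidki p Mod gs_stab p n) \<subseteq> carrier (BijGroup ?L)"
    using h.FactGroup_the_elem_mem gs_stab_eq_kernel[OF assms] by auto
  moreover have "inj_on (\<lambda>X. the_elem ((\<lambda>f. restrict f ?L) ` X))
      (carrier (gupta_sidki p Mod gs_stab p n))"
    using h.FactGroup_inj_on gs_stab_eq_kernel[OF assms] by simp
  ultimately show ?thesis by (meson finite_subset inj_on_finite)
qed

end

theory Submission
  imports Defs "HOL-Number_Theory.Cong"
begin

text \<open>
Everything is computed with words in \<open>a\<^sup>\<plusminus>\<^sup>1\<close> and \<open>b\<^sup>\<plusminus>\<^sup>1\<close>.  A word \<open>w\<close> carries two exponents
\<open>exp_a w\<close>, \<open>exp_b w\<close> and a third coordinate \<open>exp_c w\<close>, which together are its image in the integral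
Heisenberg group; modulo \<open>p\<close> the first two describe an element modulo the derived subgroup, and
\<open>exp_c\<close> describes a derived element modulo the third term of the lower central series.  The section of a
word at a vertex is again a word.  The \<open>b\<close>-exponents of the sections of \<open>w\<close> on the first level form
a function on \<open>\<int>/p\<close>, the profile of \<open>w\<close>.  It determines the exponents of all these sections, its sum
is \<open>exp_b w\<close>, and its first moment is essentially \<open>exp_c w\<close>.

Let \<open>x\<close>, \<open>y\<close> be words with \<open>a\<close>-exponents \<open>1\<close>, \<open>0\<close> and let \<open>y\<close> have \<open>b\<close>-exponent \<open>1\<close>.  Conjugation
by \<open>x\<close> shifts profiles, so that the product of the \<open>x\<^sup>j w\<^sup>e x\<^sup>-\<^sup>j\<close> with \<open>e = j\<^sup>d\<close> over \<open>j < p\<close> has as profile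
the convolution of the profile of \<open>w\<close> with \<open>j\<^sup>d\<close>, a polynomial function of degree at most \<open>d\<close> whose
coefficients are moments of that profile.  For \<open>w = y\<close> and \<open>d = 1, 0\<close> this yields a pair
of words in the stabiliser of the first level whose sections at \<^emph>\<open>every\<close> vertex have the exponents
required of \<open>x\<close>, \<open>y\<close>.  The construction can therefore be repeated on all levels at once
(\<open>frame_Suc\<close>), and each repetition multiplies lengths by at most \<open>p\<^sup>3 + p\<close>.

Alongside this pair, a family of \<open>p\<^sup>m\<close> words is carried whose level \<open>m\<close> sections are derived and whose
\<open>exp_c\<close>, as functions on the vertices of level \<open>m\<close>, span all functions to \<open>\<int>/p\<close>.  Passing to the next
level uses commutators with \<open>y\<close> and conjugates by powers of \<open>x\<close>: a family of functions of a vertex and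
a letter that is closed under cyclic shifts of the letter spans everything once its sums over the letter span,
because the group algebra of a cyclic group of order \<open>p\<close> over \<open>\<int>/p\<close> is local
(\<open>shift_span_everything\<close>, a form of Nakayama's lemma).

Upper bound: the conjugates of the family on level \<open>m\<close> fill the quotient between two consecutive subgroups
of the descending chain of elements with derived sections on level \<open>m\<close> (\<open>frame_cover\<close>).  Every element
is thus, modulo the stabiliser of level \<open>n\<close>, a product of \<open>O(p\<^sup>m)\<close> words of length \<open>O((p\<^sup>3 + p)\<^sup>m)\<close> for each
\<open>m < n\<close>, of total length \<open>O((p\<^sup>4 + p\<^sup>2)\<^sup>n)\<close>, and \<open>p\<^sup>4 + p\<^sup>2\<close> is at most \<open>gs_const p\<close>.  The words \<open>x\<close>, \<open>y\<close>
on level \<open>0\<close> are found with length at most \<open>2 p\<close> in any generating set, because the exponents modulo \<open>p\<close> are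
well defined on the group.  Lower bound for the index: an element that acts trivially two levels below
a vertex has vanishing \<open>exp_c\<close> there, so the same family produces \<open>p\<close> to the power \<open>p\<^sup>m\<close> distinct cosets
of the stabiliser of level \<open>m + 2\<close> (\<open>card_rcosets_lower\<close>).  Hence the logarithm of the index is at least
a multiple of \<open>p\<^sup>n\<close>, and the second estimate follows from the first.
\<close>

section \<open>Sums of periodic functions modulo an odd prime\<close>

locale odd_prime =
  fixes p :: nat
  assumes prime: "prime p" and odd: "odd p"
begin

lemma p_ge_3: "p \<ge> 3"
  using prime odd prime_ge_2_nat[OF prime] by (cases "p = 2") auto

lemma p_pos: "p > 0"
  using p_ge_3 by simp

text \<open>Functions from \<open>\<int>/p\<close> to \<open>\<int>/p\<close> are represented by integer functions that respect congruence, so that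
the modulus can remain a variable instead of becoming part of a type.\<close>

definition periodic :: "(int \<Rightarrow> int) \<Rightarrow> bool" where
  "periodic f \<longleftrightarrow> (\<forall>i j. [i = j] (mod int p) \<longrightarrow> [f i = f j] (mod int p))"

lemma periodicD: "periodic f \<Longrightarrow> [i = j] (mod int p) \<Longrightarrow> [f i = f j] (mod int p)"
  by (auto simp: periodic_def)

lemma periodic_id: "periodic (\<lambda>i. i)"
  and periodic_const: "periodic (\<lambda>i. c)"
  and periodic_add: "periodic f \<Longrightarrow> periodic g \<Longrightarrow> periodic (\<lambda>i. f i + g i)"
  and periodic_diff: "periodic f \<Longrightarrow> periodic g \<Longrightarrow> periodic (\<lambda>i. f i - g i)"
  and periodic_mult: "periodic f \<Longrightarrow> periodic g \<Longrightarrow> periodic (\<lambda>i. f i * g i)"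
  and periodic_uminus: "periodic f \<Longrightarrow> periodic (\<lambda>i. - f i)"
  and periodic_power: "periodic f \<Longrightarrow> periodic (\<lambda>i. f i ^ n)"
  by (auto simp: periodic_def intro: cong_add cong_diff cong_mult cong_pow)
    (simp add: cong_minus_minus_iff)

lemma periodic_sum: "(\<And>x. x \<in> A \<Longrightarrow> periodic (f x)) \<Longrightarrow> periodic (\<lambda>i. \<Sum>x\<in>A. f x i)"
  by (auto simp: periodic_def intro!: cong_sum)

lemma periodic_shift: "periodic f \<Longrightarrow> periodic (\<lambda>i. f (i + c))"
  and periodic_shift': "periodic f \<Longrightarrow> periodic (\<lambda>i. f (i - c))"
  and periodic_reflect: "periodic f \<Longrightarrow> periodic (\<lambda>i. f (c - i))"
  unfolding periodic_def by (blast intro: cong_add cong_diff cong_refl)+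

text \<open>An injective map of \<open>\<int>/p\<close> into itself permutes the residues.\<close>

lemma sum_reindex_mod:
  assumes f: "periodic f" and g: "\<And>i j. [g i = g j] (mod int p) \<Longrightarrow> [i = j] (mod int p)"
  shows "[(\<Sum>i<p. f (g (int i))) = (\<Sum>i<p. f (int i))] (mod int p)"
proof -
  define r where "r i = nat (g (int i) mod int p)" for i
  have r: "int (r i) = g (int i) mod int p" for i
    using p_pos by (simp add: r_def)
  have "inj_on r {..<p}"
  proof (rule inj_onI)
    fix i j assume ij: "i \<in> {..<p}" "j \<in> {..<p}" "r i = r j"
    then have "[g (int i) = g (int j)] (mod int p)" by (metis r cong_def)
    then have "[int i = int j] (mod int p)" by (rule g)
    then show "i = j" using ij by (simp add: cong_def)
  qed
  moreover have "r ` {..<p} \<subseteq> {..<p}"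
    using p_pos by (auto simp: r_def nat_less_iff)
  ultimately have r_bij: "bij_betw r {..<p} {..<p}"
    by (simp add: bij_betw_def endo_inj_surj)
  have "[(\<Sum>i<p. f (g (int i))) = (\<Sum>i<p. f (int (r i)))] (mod int p)"
    by (intro cong_sum periodicD[OF f]) (simp add: r)
  also have "(\<Sum>i<p. f (int (r i))) = (\<Sum>i<p. f (int i))"
    by (rule sum.reindex_bij_betw[OF r_bij])
  finally show ?thesis .
qed

lemma sum_shift: "periodic f \<Longrightarrow> [(\<Sum>i<p. f (int i + c)) = (\<Sum>i<p. f (int i))] (mod int p)"
  by (rule sum_reindex_mod[where g = "\<lambda>i. i + c"]) (auto simp: cong_add_rcancel)

lemma sum_shift': "periodic f \<Longrightarrow> [(\<Sum>i<p. f (int i - c)) = (\<Sum>i<p. f (int i))] (mod int p)"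
  using sum_shift[of f "- c"] by simp

lemma sum_reflect: "periodic f \<Longrightarrow> [(\<Sum>i<p. f (c - int i)) = (\<Sum>i<p. f (int i))] (mod int p)"
  by (rule sum_reindex_mod[where g = "\<lambda>i. c - i"])
    (auto simp: cong_iff_dvd_diff dvd_diff_commute)

text \<open>With \<open>t\<close> the shift by one, this is \<open>1 - t\<close>, a generator of the augmentation ideal of the group algebra
of \<open>\<int>/p\<close>.\<close>

definition diff_op :: "(int \<Rightarrow> int) \<Rightarrow> int \<Rightarrow> int" where
  "diff_op f i = f i - f (i - 1)"

lemma diff_op_pow_cong:
  assumes "\<And>i. [f i = g i] (mod int p)"
  shows "[(diff_op ^^ k) f i = (diff_op ^^ k) g i] (mod int p)"
  using assms by (induction k arbitrary: i) (auto simp: diff_op_def intro: cong_diff)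

lemma diff_op_pow_add:
  "(diff_op ^^ k) (\<lambda>i. f i + g i) = (\<lambda>i. (diff_op ^^ k) f i + (diff_op ^^ k) g i)"
  by (induction k) (auto simp: diff_op_def fun_eq_iff)

lemma diff_op_pow_binomial:
  "(diff_op ^^ n) f i = (\<Sum>k\<le>n. (- 1) ^ k * int (n choose k) * f (i - int k))"
proof (induction n arbitrary: i)
  case (Suc n)
  let ?t = "\<lambda>n k. (- 1) ^ k * int (n choose k) * f (i - int k)"
  have "(diff_op ^^ Suc n) f i = (\<Sum>k\<le>n. ?t n k)
      + (\<Sum>k\<le>n. (- 1) ^ Suc k * int (n choose k) * f (i - int (Suc k)))"
    by (simp add: diff_op_def Suc sum_negf algebra_simps)
  also have "(\<Sum>k\<le>n. ?t n k) = (\<Sum>k\<le>Suc n. ?t n k)"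
    by simp
  also have "\<dots> = f i + (\<Sum>k\<le>n. (- 1) ^ Suc k * int (n choose Suc k) * f (i - int (Suc k)))"
    by (subst sum.atMost_Suc_shift) simp
  also have "\<dots> + (\<Sum>k\<le>n. (- 1) ^ Suc k * int (n choose k) * f (i - int (Suc k)))
      = f i + (\<Sum>k\<le>n. (- 1) ^ Suc k * int (Suc n choose Suc k) * f (i - int (Suc k)))"
    by (simp add: sum.distrib[symmetric] algebra_simps)
  also have "\<dots> = (\<Sum>k\<le>Suc n. ?t (Suc n) k)"
    by (subst sum.atMost_Suc_shift) simp
  finally show ?case .
qed simp

text \<open>\<open>(1 - t)\<^sup>p = 1 - t\<^sup>p = 0\<close> in characteristic \<open>p\<close>: the inner binomial coefficients are divisible by \<open>p\<close>,
and the two outer terms cancel since \<open>p\<close> is odd.\<close>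

lemma diff_op_pow_prime:
  assumes f: "periodic f"
  shows "[(diff_op ^^ p) f i = 0] (mod int p)"
proof -
  let ?t = "\<lambda>k. (- 1) ^ k * int (p choose k) * f (i - int k)"
  have "[(\<Sum>k\<le>p. ?t k) = (\<Sum>k\<le>p. if k = 0 then f i else if k = p then - f i else 0)] (mod int p)"
  proof (rule cong_sum)
    fix k assume "k \<in> {..p}"
    then consider "k = 0" | "k = p" "k \<noteq> 0" | "0 < k" "k < p" by fastforce
    then show "[?t k = (if k = 0 then f i else if k = p then - f i else 0)] (mod int p)"
    proof cases
      case 2
      have "[f (i - int p) = f i] (mod int p)" by (rule periodicD[OF f]) (simp add: cong_def)
      then show ?thesis using 2 odd by (simp add: cong_minus_minus_iff)
    next
      case 3
      then have "p dvd (p choose k)"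
        using prime by (intro dvd_choose_prime) auto
      then show ?thesis using 3 by (auto simp: cong_0_iff)
    qed simp
  qed
  also have "(\<Sum>k\<le>p. if k = 0 then f i else if k = p then - f i else 0) = 0"
  proof -
    have "(\<Sum>k\<le>p. if k = 0 then f i else if k = p then - f i else 0)
        = (\<Sum>k\<in>{0, p}. if k = 0 then f i else if k = p then - f i else 0)"
      by (rule sum.mono_neutral_right) auto
    then show ?thesis using p_pos by simp
  qed
  finally show ?thesis by (simp add: diff_op_pow_binomial)
qed

text \<open>The antidifference is the sequence of partial sums; the vanishing of the full sum makes it periodic.\<close>

lemma ex_antidifference:
  assumes f: "periodic f" and s: "[(\<Sum>i<p. f (int i)) = 0] (mod int p)"
  shows "\<exists>g. periodic g \<and> (\<forall>i. [f i = diff_op g i] (mod int p))"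
proof -
  define g where "g i = (\<Sum>l<Suc (nat (i mod int p)). f (int l))" for i
  have "periodic g" by (auto simp: periodic_def g_def cong_def)
  moreover have "[f i = diff_op g i] (mod int p)" for i
  proof (cases "i mod int p = 0")
    case True
    have m: "(i - 1) mod int p = int p - 1"
    proof -
      from True obtain q where "i = int p * q" by (auto simp: mod_eq_0_iff_dvd)
      then have "i - 1 = (int p - 1) + (q - 1) * int p" by (simp add: algebra_simps)
      then have "(i - 1) mod int p = (int p - 1) mod int p" by (simp only: mod_mult_self1)
      then show ?thesis using p_pos mod_pos_pos_trivial[of "int p - 1" "int p"] by linarith
    qed
    have "Suc (nat ((i - 1) mod int p)) = p" using p_pos by (simp add: m)
    then have "diff_op g i = f 0 - (\<Sum>l<p. f (int l))"
      by (simp only: diff_op_def g_def True) simp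
    moreover have "[f i = f 0] (mod int p)"
      by (rule periodicD[OF f]) (simp add: cong_def True)
    ultimately show ?thesis using cong_diff[OF _ cong_sym[OF s], of "f i" "f 0"] by simp
  next
    case False
    define k where "k = nat (i mod int p) - 1"
    have k: "i mod int p = int (Suc k)" "Suc k < p"
      using False p_pos pos_mod_bound[of "int p" i] pos_mod_sign[of "int p" i]
      unfolding k_def by linarith+
    then have m: "(i - 1) mod int p = int k"
      using mod_diff_left_eq[of i "int p" 1] by simp
    have "diff_op g i = f (int (Suc k))"
      by (simp only: diff_op_def g_def k(1) m nat_int) simp
    moreover have "[f i = f (int (Suc k))] (mod int p)"
      by (rule periodicD[OF f]) (use k in \<open>simp add: cong_def\<close>)
    ultimately show ?thesis by simp
  qed
  ultimately show ?thesis by blast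
qed

section \<open>Families of functions spanned by their cyclic shifts\<close>

text \<open>Only congruences on \<open>V\<close> are demanded, so this speaks of the span in the space of functions from \<open>V\<close> to
\<open>\<int>/p\<close>.\<close>

definition spans_mod :: "'v set \<Rightarrow> 'i set \<Rightarrow> ('i \<Rightarrow> 'v \<Rightarrow> int) \<Rightarrow> bool" where
  "spans_mod V I g \<longleftrightarrow>
    (\<forall>\<phi>. \<exists>e. \<forall>v\<in>V. [(\<Sum>f\<in>I. e f * g f v) = \<phi> v] (mod int p))"

lemma spans_mod_scale:
  assumes g: "spans_mod V I g" and c: "coprime c (int p)"
    and h: "\<And>f v. f \<in> I \<Longrightarrow> v \<in> V \<Longrightarrow> [h f v = c * g f v] (mod int p)"
  shows "spans_mod V I h"
  unfolding spans_mod_def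
proof
  fix \<phi>
  obtain d where d: "[c * d = 1] (mod int p)" using cong_solve_coprime_int[OF c] by blast
  obtain e where e: "\<And>v. v \<in> V \<Longrightarrow> [(\<Sum>f\<in>I. e f * g f v) = d * \<phi> v] (mod int p)"
    using spec[OF g[unfolded spans_mod_def], of "\<lambda>v. d * \<phi> v"] by blast
  show "\<exists>e. \<forall>v\<in>V. [(\<Sum>f\<in>I. e f * h f v) = \<phi> v] (mod int p)"
  proof (intro exI ballI)
    fix v assume v: "v \<in> V"
    have "[(\<Sum>f\<in>I. e f * h f v) = (\<Sum>f\<in>I. e f * (c * g f v))] (mod int p)"
      using h v by (intro cong_sum cong_mult) auto
    also have "(\<Sum>f\<in>I. e f * (c * g f v)) = c * (\<Sum>f\<in>I. e f * g f v)"
      by (simp add: sum_distrib_left ac_simps)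
    also have "[\<dots> = c * (d * \<phi> v)] (mod int p)"
      using e[OF v] by (intro cong_mult) auto
    also have "[c * (d * \<phi> v) = 1 * \<phi> v] (mod int p)"
      using d cong_mult[OF d, of "\<phi> v" "\<phi> v"] by (simp add: mult.assoc)
    finally show "[(\<Sum>f\<in>I. e f * h f v) = \<phi> v] (mod int p)" by simp
  qed
qed

text \<open>The submodule over the group algebra of \<open>\<int>/p\<close> generated by the functions \<open>h f\<close>, whose second argument is
the one that is shifted.  Coefficients are periodic in the shift \<open>j\<close>, which makes the
submodule visibly stable under shifts.\<close>

definition shift_span :: "'v set \<Rightarrow> 'i set \<Rightarrow> ('i \<Rightarrow> 'v \<Rightarrow> int \<Rightarrow> int) \<Rightarrow> ('v \<Rightarrow> int \<Rightarrow> int) \<Rightarrow> bool" where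
  "shift_span V I h \<phi> \<longleftrightarrow> (\<exists>e. (\<forall>f\<in>I. periodic (e f)) \<and>
    (\<forall>v\<in>V. \<forall>i. [(\<Sum>f\<in>I. \<Sum>j<p. e f (int j) * h f v (i - int j)) = \<phi> v i] (mod int p)))"

lemma shift_spanI:
  assumes "\<And>f. f \<in> I \<Longrightarrow> periodic (e f)"
    and "\<And>v i. v \<in> V \<Longrightarrow>
      [(\<Sum>f\<in>I. \<Sum>j<p. e f (int j) * h f v (i - int j)) = \<phi> v i] (mod int p)"
  shows "shift_span V I h \<phi>"
  unfolding shift_span_def by (rule exI[of _ e], intro conjI ballI allI) (fact assms)+

lemma shift_spanE:
  assumes "shift_span V I h \<phi>"
  obtains e where "\<And>f. f \<in> I \<Longrightarrow> periodic (e f)"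
    and "\<And>v i. v \<in> V \<Longrightarrow>
      [(\<Sum>f\<in>I. \<Sum>j<p. e f (int j) * h f v (i - int j)) = \<phi> v i] (mod int p)"
proof -
  from assms[unfolded shift_span_def] obtain e where
    e: "(\<forall>f\<in>I. periodic (e f)) \<and>
    (\<forall>v\<in>V. \<forall>i. [(\<Sum>f\<in>I. \<Sum>j<p. e f (int j) * h f v (i - int j)) = \<phi> v i] (mod int p))" ..
  show thesis by (rule that[of e]) (simp_all add: e)
qed

lemma shift_span_add:
  assumes "shift_span V I h \<phi>" "shift_span V I h \<psi>"
  shows "shift_span V I h (\<lambda>v i. \<phi> v i + \<psi> v i)"
proof (rule shift_spanE[OF assms(1)], rule shift_spanE[OF assms(2)])
  fix e e'
  assume e: "\<And>f. f \<in> I \<Longrightarrow> periodic (e f)" "\<And>v i. v \<in> V \<Longrightarrow>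
      [(\<Sum>f\<in>I. \<Sum>j<p. e f (int j) * h f v (i - int j)) = \<phi> v i] (mod int p)"
    and e': "\<And>f. f \<in> I \<Longrightarrow> periodic (e' f)" "\<And>v i. v \<in> V \<Longrightarrow>
      [(\<Sum>f\<in>I. \<Sum>j<p. e' f (int j) * h f v (i - int j)) = \<psi> v i] (mod int p)"
  show ?thesis
  proof (rule shift_spanI[of I "\<lambda>f i. e f i + e' f i"])
    show "periodic (\<lambda>i. e f i + e' f i)" if "f \<in> I" for f
      by (intro periodic_add e e' that)
    show "[(\<Sum>f\<in>I. \<Sum>j<p. (e f (int j) + e' f (int j)) * h f v (i - int j)) = \<phi> v i + \<psi> v i] (mod int p)"
      if "v \<in> V" for v i
      using cong_add[OF e(2) e'(2), OF that that] by (simp only: distrib_right sum.distrib)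
  qed
qed

lemma shift_span_uminus:
  assumes "shift_span V I h \<phi>"
  shows "shift_span V I h (\<lambda>v i. - \<phi> v i)"
proof (rule shift_spanE[OF assms])
  fix e
  assume e: "\<And>f. f \<in> I \<Longrightarrow> periodic (e f)" "\<And>v i. v \<in> V \<Longrightarrow>
      [(\<Sum>f\<in>I. \<Sum>j<p. e f (int j) * h f v (i - int j)) = \<phi> v i] (mod int p)"
  show ?thesis
  proof (rule shift_spanI[of I "\<lambda>f i. - e f i"])
    show "periodic (\<lambda>i. - e f i)" if "f \<in> I" for f
      by (intro periodic_uminus e that)
    show "[(\<Sum>f\<in>I. \<Sum>j<p. - e f (int j) * h f v (i - int j)) = - \<phi> v i] (mod int p)"
      if "v \<in> V" for v i
      using e(2)[OF that] by (simp add: sum_negf cong_minus_minus_iff)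
  qed
qed

lemma shift_span_shift:
  assumes h: "\<forall>f\<in>I. \<forall>v\<in>V. periodic (h f v)"
    and "shift_span V I h \<phi>"
  shows "shift_span V I h (\<lambda>v i. \<phi> v (i - 1))"
proof (rule shift_spanE[OF assms(2)])
  fix e
  assume e: "\<And>f. f \<in> I \<Longrightarrow> periodic (e f)" "\<And>v i. v \<in> V \<Longrightarrow>
      [(\<Sum>f\<in>I. \<Sum>j<p. e f (int j) * h f v (i - int j)) = \<phi> v i] (mod int p)"
  show ?thesis
  proof (rule shift_spanI[of I "\<lambda>f j. e f (j - 1)"])
    show "periodic (\<lambda>j. e f (j - 1))" if "f \<in> I" for f
      by (rule periodic_shift'[OF e(1)[OF that]])
    fix v i assume v: "v \<in> V"
    have "[(\<Sum>f\<in>I. \<Sum>j<p. e f (int j - 1) * h f v (i - int j))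
        = (\<Sum>f\<in>I. \<Sum>j<p. e f (int j) * h f v (i - 1 - int j))] (mod int p)"
    proof (rule cong_sum)
      fix f assume f: "f \<in> I"
      have "periodic (\<lambda>j. e f (j - 1) * h f v (i - j))"
        by (rule periodic_mult[OF periodic_shift'[OF e(1)[OF f]] periodic_reflect[OF h[rule_format, OF f v]]])
      from cong_sym[OF sum_shift[OF this, of 1]]
      show "[(\<Sum>j<p. e f (int j - 1) * h f v (i - int j))
          = (\<Sum>j<p. e f (int j) * h f v (i - 1 - int j))] (mod int p)"
        by (simp add: algebra_simps)
    qed
    then show "[(\<Sum>f\<in>I. \<Sum>j<p. e f (int j - 1) * h f v (i - int j)) = \<phi> v (i - 1)] (mod int p)"
      using e(2)[OF v, of "i - 1"] by (rule cong_trans)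
  qed
qed

lemma shift_span_diff_op:
  assumes h: "\<forall>f\<in>I. \<forall>v\<in>V. periodic (h f v)"
    and \<phi>: "shift_span V I h \<phi>"
  shows "shift_span V I h (\<lambda>v. diff_op (\<phi> v))"
  using shift_span_add[OF \<phi> shift_span_uminus[OF shift_span_shift[OF h \<phi>]]]
  by (simp add: diff_op_def[abs_def])

lemma shift_span_diff_op_pow:
  assumes h: "\<forall>f\<in>I. \<forall>v\<in>V. periodic (h f v)"
    and \<phi>: "shift_span V I h \<phi>"
  shows "shift_span V I h (\<lambda>v. (diff_op ^^ k) (\<phi> v))"
proof (induction k)
  case (Suc k)
  have "shift_span V I h (\<lambda>v. diff_op ((diff_op ^^ k) (\<phi> v)))"
    by (rule shift_span_diff_op[OF h Suc])
  then show ?case by simp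
qed (simp add: \<phi>)

lemma shift_span_cong:
  assumes "shift_span V I h \<phi>" and "\<And>v i. v \<in> V \<Longrightarrow> [\<phi> v i = \<psi> v i] (mod int p)"
  shows "shift_span V I h \<psi>"
  using assms(1)
proof (rule shift_spanE)
  fix e assume e: "\<And>f. f \<in> I \<Longrightarrow> periodic (e f)" "\<And>v i. v \<in> V \<Longrightarrow>
      [(\<Sum>f\<in>I. \<Sum>j<p. e f (int j) * h f v (i - int j)) = \<phi> v i] (mod int p)"
  show ?thesis
    by (rule shift_spanI[OF e(1)], assumption, rule cong_trans[OF e(2) assms(2)])
qed

text \<open>Subtracting a combination of the generators with the right sums leaves a function with vanishing sums, and
such a function is a difference.\<close>

lemma shift_span_mod_diff_op:
  assumes h: "\<forall>f\<in>I. \<forall>v\<in>V. periodic (h f v)"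
    and span: "spans_mod V I (\<lambda>f v. \<Sum>i<p. h f v (int i))"
    and \<phi>: "\<forall>v\<in>V. periodic (\<phi> v)"
  shows "\<exists>\<psi> \<eta>. shift_span V I h \<psi> \<and> (\<forall>v\<in>V. periodic (\<eta> v)) \<and>
    (\<forall>v\<in>V. \<forall>i. [\<phi> v i = \<psi> v i + diff_op (\<eta> v) i] (mod int p))"
proof -
  from spec[OF span[unfolded spans_mod_def], of "\<lambda>v. \<Sum>i<p. \<phi> v (int i)"] obtain e where
    e: "\<forall>v\<in>V. [(\<Sum>f\<in>I. e f * (\<Sum>i<p. h f v (int i))) = (\<Sum>i<p. \<phi> v (int i))] (mod int p)" ..
  define \<psi> where "\<psi> v i = (\<Sum>f\<in>I. e f * h f v i)" for v i
  have "shift_span V I h \<psi>"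
  proof (rule shift_spanI[of I "\<lambda>f j. if [j = 0] (mod int p) then e f else 0"])
    show "periodic (\<lambda>j. if [j = 0] (mod int p) then e f else 0)" for f
      by (simp add: periodic_def cong_def)
    show "[(\<Sum>f\<in>I. \<Sum>j<p. (if [int j = 0] (mod int p) then e f else 0) * h f v (i - int j))
      = \<psi> v i] (mod int p)" for v i
    proof -
      have "(\<Sum>j<p. (if [int j = 0] (mod int p) then e f else 0) * h f v (i - int j))
          = e f * h f v i" for f
      proof -
        have "(\<Sum>j<p. (if [int j = 0] (mod int p) then e f else 0) * h f v (i - int j))
          = (\<Sum>j<p. if j = 0 then e f * h f v i else 0)"
          by (rule sum.cong) (auto simp: cong_def)
        then show ?thesis using p_pos by (simp add: sum.delta)
      qed
      then show ?thesis by (simp add: \<psi>_def)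
    qed
  qed
  moreover have "\<exists>\<eta>. periodic \<eta> \<and> (\<forall>i. [\<phi> v i - \<psi> v i = diff_op \<eta> i] (mod int p))" if v: "v \<in> V" for v
  proof (rule ex_antidifference)
    show "periodic (\<lambda>i. \<phi> v i - \<psi> v i)"
      unfolding \<psi>_def using v h \<phi> by (simp add: periodic_diff periodic_sum periodic_mult periodic_const)
    have "(\<Sum>i<p. \<psi> v (int i)) = (\<Sum>f\<in>I. e f * (\<Sum>i<p. h f v (int i)))"
      unfolding \<psi>_def by (subst sum.swap) (simp add: sum_distrib_left)
    then show "[(\<Sum>i<p. \<phi> v (int i) - \<psi> v (int i)) = 0] (mod int p)"
      using cong_sym[OF bspec[OF e v]] by (simp add: sum_subtractf cong_diff_iff_cong_0)
  qed
  then obtain \<eta> where "\<And>v. v \<in> V \<Longrightarrow> periodic (\<eta> v) \<and>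
      (\<forall>i. [\<phi> v i - \<psi> v i = diff_op (\<eta> v) i] (mod int p))"
    by metis
  moreover from this have "[\<phi> v i = \<psi> v i + diff_op (\<eta> v) i] (mod int p)" if "v \<in> V" for v i
    using cong_add[OF _ cong_refl[of "\<psi> v i"], of "\<phi> v i - \<psi> v i" "diff_op (\<eta> v) i" "int p"] that
    by (simp add: add.commute)
  ultimately show ?thesis by blast
qed

text \<open>Nakayama's lemma for the group algebra of \<open>\<int>/p\<close>.  Modulo the augmentation ideal the generators span
everything, so iterating the preceding lemma expresses any function up to an element of an
arbitrarily high power of that ideal, and the \<open>p\<close>-th power vanishes.\<close>

lemma shift_span_everything:
  assumes h: "\<forall>f\<in>I. \<forall>v\<in>V. periodic (h f v)"
    and span: "spans_mod V I (\<lambda>f v. \<Sum>i<p. h f v (int i))"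
    and \<phi>: "\<forall>v\<in>V. periodic (\<phi> v)"
  shows "shift_span V I h \<phi>"
proof -
  have "\<exists>\<psi> \<eta>. shift_span V I h \<psi> \<and> (\<forall>v\<in>V. periodic (\<eta> v)) \<and>
    (\<forall>v\<in>V. \<forall>i. [\<phi> v i = \<psi> v i + (diff_op ^^ k) (\<eta> v) i] (mod int p))" for k
  proof (induction k)
    case 0
    have "shift_span V I h (\<lambda>v i. 0)"
      by (rule shift_spanI[of I "\<lambda>_ _. 0"]) (simp_all add: periodic_const)
    then show ?case using \<phi> by (intro exI[of _ "\<lambda>v i. 0"] exI[of _ \<phi>]) simp
  next
    case (Suc k)
    then obtain \<psi> \<eta> where 1: "shift_span V I h \<psi>" "\<forall>v\<in>V. periodic (\<eta> v)"
      "\<forall>v\<in>V. \<forall>i. [\<phi> v i = \<psi> v i + (diff_op ^^ k) (\<eta> v) i] (mod int p)" by blast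
    obtain \<psi>' \<eta>' where 2: "shift_span V I h \<psi>'" "\<forall>v\<in>V. periodic (\<eta>' v)"
      "\<forall>v\<in>V. \<forall>i. [\<eta> v i = \<psi>' v i + diff_op (\<eta>' v) i] (mod int p)"
      using shift_span_mod_diff_op[OF h span 1(2)] by blast
    have "[\<phi> v i = (\<psi> v i + (diff_op ^^ k) (\<psi>' v) i) + (diff_op ^^ Suc k) (\<eta>' v) i] (mod int p)"
      if v: "v \<in> V" for v i
    proof -
      have "[(diff_op ^^ k) (\<eta> v) i = (diff_op ^^ k) (\<lambda>i. \<psi>' v i + diff_op (\<eta>' v) i) i] (mod int p)"
        using 2(3) v by (simp add: diff_op_pow_cong)
      then have "[(diff_op ^^ k) (\<eta> v) i = (diff_op ^^ k) (\<psi>' v) i + (diff_op ^^ Suc k) (\<eta>' v) i] (mod int p)"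
        by (simp add: diff_op_pow_add funpow_swap1)
      from cong_trans[OF 1(3)[rule_format, OF v] cong_add[OF cong_refl this]] show ?thesis
        by (simp only: add.assoc)
    qed
    moreover have "shift_span V I h (\<lambda>v i. \<psi> v i + (diff_op ^^ k) (\<psi>' v) i)"
      by (intro shift_span_add shift_span_diff_op_pow 1 2 h)
    ultimately show ?case using 2(2) by blast
  qed
  from this[of p] obtain \<psi> \<eta> where 1: "shift_span V I h \<psi>" "\<forall>v\<in>V. periodic (\<eta> v)"
      "\<forall>v\<in>V. \<forall>i. [\<phi> v i = \<psi> v i + (diff_op ^^ p) (\<eta> v) i] (mod int p)" by blast
  have "[\<psi> v i = \<phi> v i] (mod int p)" if v: "v \<in> V" for v i
    using cong_trans[OF 1(3)[rule_format, OF v]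
        cong_add[OF cong_refl diff_op_pow_prime[OF 1(2)[rule_format, OF v]]]]
    by (simp add: cong_sym_eq)
  then show ?thesis by (rule shift_span_cong[OF 1(1)])
qed

end

section \<open>Words, exponents and sections\<close>

text \<open>The flag is \<^const>\<open>True\<close> for a generator and \<^const>\<open>False\<close> for its inverse.\<close>

datatype letter = A bool | B bool

type_synonym word = "letter list"

fun letter_sign :: "bool \<Rightarrow> int" where
  "letter_sign True = 1" | "letter_sign False = - 1"

fun letter_a :: "letter \<Rightarrow> int" where
  "letter_a (A e) = letter_sign e" | "letter_a (B e) = 0"

fun letter_b :: "letter \<Rightarrow> int" where
  "letter_b (A e) = 0" | "letter_b (B e) = letter_sign e"

fun letter_inv :: "letter \<Rightarrow> letter" where
  "letter_inv (A e) = A (\<not> e)" | "letter_inv (B e) = B (\<not> e)"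

definition exp_a :: "word \<Rightarrow> int" where "exp_a w = (\<Sum>l\<leftarrow>w. letter_a l)"
definition exp_b :: "word \<Rightarrow> int" where "exp_b w = (\<Sum>l\<leftarrow>w. letter_b l)"

text \<open>Together with the two other exponents this is the homomorphism to the Heisenberg group of triples with
\<open>(\<alpha>, \<beta>, \<gamma>) (\<alpha>', \<beta>', \<gamma>') = (\<alpha> + \<alpha>', \<beta> + \<beta>', \<gamma> + \<gamma>' + \<alpha> \<beta>')\<close>.\<close>

fun exp_c :: "word \<Rightarrow> int" where
  "exp_c [] = 0"
| "exp_c (l # w) = exp_c w + letter_a l * exp_b w"

definition winv :: "word \<Rightarrow> word" where "winv w = rev (map letter_inv w)"

definition wpow :: "word \<Rightarrow> nat \<Rightarrow> word" where "wpow w n = concat (replicate n w)"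

definition wcomm :: "word \<Rightarrow> word \<Rightarrow> word" where "wcomm u v = u @ v @ winv u @ winv v"

definition wconj :: "word \<Rightarrow> nat \<Rightarrow> word \<Rightarrow> word" where
  "wconj x j w = wpow x j @ w @ winv (wpow x j)"

text \<open>The product over \<open>j < n\<close> of \<open>w ^ e j\<close> conjugated by \<open>x ^ j\<close>.  On profiles it
is convolution with \<open>e\<close>, which for \<open>e j = j ^ d\<close> turns moments of a profile into coefficients.\<close>

definition moment_word :: "word \<Rightarrow> (nat \<Rightarrow> nat) \<Rightarrow> nat \<Rightarrow> word \<Rightarrow> word" where
  "moment_word x e n w = concat (map (\<lambda>j. wconj x j (wpow w (e j))) [0..<n])"

lemma letter_sign_not [simp]: "letter_sign (\<not> e) = - letter_sign e"
  by (cases e) auto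

lemma letter_inv_simps [simp]: "letter_a (letter_inv l) = - letter_a l" "letter_b (letter_inv l) = - letter_b l"
  "letter_inv (letter_inv l) = l"
  by (cases l; simp)+

lemma exp_a_simps [simp]: "exp_a [] = 0" "exp_a (l # w) = letter_a l + exp_a w" "exp_a (u @ w) = exp_a u + exp_a w"
  and exp_b_simps [simp]: "exp_b [] = 0" "exp_b (l # w) = letter_b l + exp_b w" "exp_b (u @ w) = exp_b u + exp_b w"
  by (simp_all add: exp_a_def exp_b_def)

lemma exp_c_append [simp]: "exp_c (u @ w) = exp_c u + exp_c w + exp_a u * exp_b w"
  by (induction u) (auto simp: algebra_simps)

lemma winv_simps [simp]: "winv [] = []" "winv (l # w) = winv w @ [letter_inv l]" "winv (u @ w) = winv w @ winv u"
  "winv (winv w) = w"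
  by (auto simp: winv_def rev_map comp_def)

lemma letter_a_times_letter_b: "letter_a l * letter_b l = 0"
  by (cases l) auto

lemma exp_winv [simp]: "exp_a (winv w) = - exp_a w" "exp_b (winv w) = - exp_b w"
  "exp_c (winv w) = exp_a w * exp_b w - exp_c w"
  by (induction w) (use letter_a_times_letter_b in \<open>auto simp: algebra_simps\<close>)

lemma wpow_simps [simp]: "wpow w 0 = []" "wpow w (Suc n) = w @ wpow w n"
  by (simp_all add: wpow_def)

lemma exp_wpow [simp]: "exp_a (wpow w n) = int n * exp_a w" "exp_b (wpow w n) = int n * exp_b w"
  by (induction n) (auto simp: algebra_simps)

lemma exp_wcomm [simp]: "exp_a (wcomm u v) = 0" "exp_b (wcomm u v) = 0"
  "exp_c (wcomm u v) = exp_a u * exp_b v - exp_a v * exp_b u"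
  by (simp_all add: wcomm_def algebra_simps)

lemma exp_wconj [simp]: "exp_a (wconj x j w) = exp_a w" "exp_b (wconj x j w) = exp_b w"
  by (simp_all add: wconj_def)

lemma moment_word_simps [simp]: "moment_word x e 0 w = []"
  "moment_word x e (Suc n) w = moment_word x e n w @ wconj x n (wpow w (e n))"
  by (simp_all add: moment_word_def)

lemma exp_a_moment_word: "exp_a (moment_word x e n w) = (\<Sum>j<n. int (e j)) * exp_a w"
  by (induction n) (auto simp: algebra_simps)

context odd_prime
begin

text \<open>The recursion \<open>b = (a, a\<^sup>-\<^sup>1, 1, \<dots>, 1, b)\<close> with positions read modulo \<open>p\<close>.\<close>

fun letter_section :: "letter \<Rightarrow> int \<Rightarrow> word" where
  "letter_section (A e) i = []"
| "letter_section (B e) i =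
    (if int p dvd i then [A e] else if int p dvd i - 1 then [A (\<not> e)]
     else if int p dvd i + 1 then [B e] else [])"

text \<open>Letters further to the right act first, so a letter meets the first letter \<open>i\<close> of the argument after
the remaining word has shifted it by its \<open>a\<close>-exponent.\<close>

fun wsection :: "int \<Rightarrow> word \<Rightarrow> word" where
  "wsection i [] = []"
| "wsection i (l # w) = letter_section l (i + exp_a w) @ wsection i w"

definition profile :: "word \<Rightarrow> int \<Rightarrow> int" where
  "profile w i = exp_b (wsection i w)"

lemma dvd_cong_shift: "[i = j] (mod int p) \<Longrightarrow> int p dvd i + c \<longleftrightarrow> int p dvd j + c"
  by (metis cong_add_rcancel cong_dvd_iff)

lemma letter_section_cong:
  assumes "[i = j] (mod int p)" shows "letter_section l i = letter_section l j"
  using dvd_cong_shift[OF assms, of 0] dvd_cong_shift[OF assms, of 1] dvd_cong_shift[OF assms, of "- 1"]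
  by (cases l) simp_all

lemma wsection_cong: "[i = j] (mod int p) \<Longrightarrow> wsection i w = wsection j w"
proof (induction w)
  case (Cons l w)
  have "[i + exp_a w = j + exp_a w] (mod int p)" using Cons.prems by (intro cong_add cong_refl)
  then show ?case using Cons by (simp add: letter_section_cong)
qed simp

lemma wsection_mod [simp]: "wsection (i mod int p) w = wsection i w"
  by (rule wsection_cong) (simp add: cong_def)

lemma wsection_append: "wsection i (u @ w) = wsection (i + exp_a w) u @ wsection i w"
  by (induction u) (auto simp: algebra_simps)

lemma letter_section_inv: "letter_section (letter_inv l) i = winv (letter_section l i)"
  by (cases l) auto

lemma wsection_winv: "wsection i (winv w) = winv (wsection (i - exp_a w) w)"
proof (induction w arbitrary: i)
  case (Cons l w)
  have "wsection i (winv (l # w)) = wsection (i - letter_a l) (winv w) @ letter_section (letter_inv l) i"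
    by (simp add: wsection_append)
  also have "\<dots> = winv (letter_section l i @ wsection (i - letter_a l - exp_a w) w)"
    by (simp add: Cons letter_section_inv)
  also have "letter_section l i = letter_section l (i - letter_a l)" by (cases l) auto
  finally show ?case by (simp add: algebra_simps)
qed simp

lemma wsection_append_stab:
  assumes "int p dvd exp_a w"
  shows "wsection i (u @ w) = wsection i u @ wsection i w"
proof -
  have "wsection (i + exp_a w) u = wsection i u"
    using assms by (intro wsection_cong) (simp add: cong_iff_dvd_diff)
  then show ?thesis by (simp add: wsection_append)
qed

lemma wsection_winv_stab:
  assumes "int p dvd exp_a w"
  shows "wsection i (winv w) = winv (wsection i w)"
proof -
  have "wsection (i - exp_a w) w = wsection i w"
    using assms by (intro wsection_cong) (simp add: cong_iff_dvd_diff)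
  then show ?thesis by (simp add: wsection_winv)
qed

lemma wsection_wpow_stab: "int p dvd exp_a w \<Longrightarrow> wsection i (wpow w n) = wpow (wsection i w) n"
  by (induction n) (auto simp: wsection_append_stab)

lemma wsection_wcomm_stab:
  "int p dvd exp_a u \<Longrightarrow> int p dvd exp_a v \<Longrightarrow> wsection i (wcomm u v) = wcomm (wsection i u) (wsection i v)"
  by (simp add: wcomm_def wsection_append_stab wsection_winv_stab)

text \<open>The conjugating word shifts the position by \<open>j\<close> and contributes mutually inverse outer factors.\<close>

lemma wsection_wconj:
  assumes x: "[exp_a x = 1] (mod int p)" and w: "int p dvd exp_a w"
  shows "\<exists>u. wsection i (wconj x j w) = u @ wsection (i - int j) w @ winv u"
proof -
  let ?X = "wpow x j"
  have 1: "wsection (i + (exp_a w - exp_a ?X)) ?X = wsection (i - exp_a ?X) ?X"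
    using w by (intro wsection_cong) (simp add: cong_iff_dvd_diff)
  have "[int j * exp_a x = int j * 1] (mod int p)" using x by (intro cong_mult cong_refl)
  then have "[i - exp_a ?X = i - int j] (mod int p)"
    using cong_diff[OF cong_refl] by simp
  then have 2: "wsection (i - exp_a ?X) w = wsection (i - int j) w" by (rule wsection_cong)
  show ?thesis
    using 1 2
    by (intro exI[of _ "wsection (i - exp_a ?X) ?X"]) (simp add: wconj_def wsection_append wsection_winv)
qed

lemma periodic_profile: "periodic (profile w)"
  unfolding periodic_def profile_def by (metis wsection_cong cong_refl)

lemma dvd_shift_unique:
  assumes "int p dvd i + c" "int p dvd i + d" "\<bar>c - d\<bar> < int p"
  shows "c = d"
proof -
  have "int p dvd c - d" using dvd_diff[OF assms(1,2)] by simp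
  then show "c = d" using assms(3) dvd_imp_le_int[of "c - d" "int p"] by fastforce
qed

lemma letter_section_exp_b:
  "exp_b (letter_section l i) = (if int p dvd i + 1 then letter_b l else 0)"
  using dvd_shift_unique[of i 0 1] dvd_shift_unique[of i "-1" 1] p_ge_3 by (cases l) auto

lemma letter_section_exp_a:
  "exp_a (letter_section l i)
    = (if int p dvd i then letter_b l else 0) - (if int p dvd i - 1 then letter_b l else 0)"
  using dvd_shift_unique[of i 0 "-1"] p_ge_3 by (cases l) auto

lemma profile_Nil [simp]: "profile [] i = 0"
  and profile_Cons: "profile (l # w) i
      = (if int p dvd i + exp_a w + 1 then letter_b l else 0) + profile w i"
  by (simp_all add: profile_def letter_section_exp_b)

text \<open>Each occurrence of \<open>b\<close> that contributes a letter \<open>b\<close> at position \<open>i - 1\<close> contributes \<open>a\<close> at position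
\<open>i\<close> and \<open>a\<^sup>-\<^sup>1\<close> at position \<open>i + 1\<close>.\<close>

lemma exp_a_wsection: "exp_a (wsection i w) = profile w (i - 1) - profile w (i - 2)"
proof (induction w)
  case (Cons l w)
  have "int p dvd i - 1 + exp_a w + 1 \<longleftrightarrow> int p dvd i + exp_a w"
    "int p dvd i - 2 + exp_a w + 1 \<longleftrightarrow> int p dvd i + exp_a w - 1"
    by (simp_all add: algebra_simps)
  then show ?case by (simp add: letter_section_exp_a profile_Cons Cons)
qed simp

lemma sum_indicator:
  "\<exists>k<p. [int k = c] (mod int p) \<and>
    (\<forall>g::nat \<Rightarrow> int. (\<Sum>i<p. g i * (if int p dvd int i - c then d else 0)) = g k * d)"
proof (intro exI conjI allI)
  let ?k = "nat (c mod int p)"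
  show k: "?k < p" using p_pos by (simp add: nat_less_iff)
  show kc: "[int ?k = c] (mod int p)" using p_pos by (simp add: cong_def)
  fix g :: "nat \<Rightarrow> int"
  have "int p dvd int i - c \<longleftrightarrow> i = ?k" if "i < p" for i
  proof -
    have "int p dvd int i - c \<longleftrightarrow> [int i = c] (mod int p)" by (simp add: cong_iff_dvd_diff)
    also have "\<dots> \<longleftrightarrow> int i = c mod int p" using that by (simp add: cong_def)
    finally show ?thesis using p_pos by auto
  qed
  then have "(\<Sum>i<p. g i * (if int p dvd int i - c then d else 0)) = (\<Sum>i<p. if i = ?k then g i * d else 0)"
    by (intro sum.cong) auto
  also have "\<dots> = g ?k * d" using k by (simp add: sum.delta)
  finally show "(\<Sum>i<p. g i * (if int p dvd int i - c then d else 0)) = g ?k * d" .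
qed

lemma sum_profile: "(\<Sum>i<p. profile w (int i)) = exp_b w"
proof (induction w)
  case (Cons l w)
  obtain k where k: "\<And>g. (\<Sum>i<p. g i * (if int p dvd int i - (- exp_a w - 1) then letter_b l else 0)) = g k * letter_b l"
    using sum_indicator[of "- exp_a w - 1" "letter_b l"] by metis
  from k[of "\<lambda>_. 1"] have "(\<Sum>i<p. if int p dvd int i + exp_a w + 1 then letter_b l else 0) = letter_b l"
    by (simp add: algebra_simps)
  then show ?case by (simp add: profile_Cons sum.distrib Cons)
qed simp

text \<open>An occurrence of \<open>b\<close> with prefix \<open>u\<close> and suffix \<open>v\<close> adds \<open>exp_a u\<close> to \<open>exp_c\<close>, and its
position is \<open>- 1 - exp_a v\<close>; the two differ by \<open>1 + exp_a w\<close>, whence the correction term.\<close>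

lemma exp_c_profile:
  "[exp_c w = (\<Sum>i<p. int i * profile w (int i)) + exp_b w * (1 + exp_a w)] (mod int p)"
proof (induction w)
  case (Cons l w)
  obtain k where k: "[int k = - exp_a w - 1] (mod int p)"
    "\<And>g. (\<Sum>i<p. g i * (if int p dvd int i - (- exp_a w - 1) then letter_b l else 0)) = g k * letter_b l"
    using sum_indicator[of "- exp_a w - 1" "letter_b l"] by metis
  let ?S = "\<Sum>i<p. int i * profile w (int i)"
  have "(\<Sum>i<p. int i * profile (l # w) (int i))
      = (\<Sum>i<p. int i * (if int p dvd int i - (- exp_a w - 1) then letter_b l else 0)) + ?S"
    by (simp add: profile_Cons sum.distrib distrib_left algebra_simps)
  also have "\<dots> = int k * letter_b l + ?S" by (simp add: k(2))
  finally have eq: "(\<Sum>i<p. int i * profile (l # w) (int i)) = int k * letter_b l + ?S" .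
  have zero: "letter_a l * letter_b l = 0" by (cases l) auto
  have "[int k * letter_b l = (- exp_a w - 1) * letter_b l] (mod int p)"
    by (rule cong_mult[OF k(1) cong_refl])
  then have "[(int k * letter_b l + ?S) + exp_b (l # w) * (1 + exp_a (l # w))
      = ((- exp_a w - 1) * letter_b l + ?S) + exp_b (l # w) * (1 + exp_a (l # w))] (mod int p)"
    by (intro cong_add cong_refl)
  also have "((- exp_a w - 1) * letter_b l + ?S) + exp_b (l # w) * (1 + exp_a (l # w))
      = (?S + exp_b w * (1 + exp_a w)) + letter_a l * exp_b w"
    using zero by (simp add: algebra_simps)
  also have "[\<dots> = exp_c (l # w)] (mod int p)"
    using cong_add[OF cong_sym[OF Cons] cong_refl] by simp
  finally show ?case unfolding eq by (rule cong_sym)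
qed simp

lemma profile_append_stab: "int p dvd exp_a w \<Longrightarrow> profile (u @ w) i = profile u i + profile w i"
  by (simp add: profile_def wsection_append_stab)

lemma profile_wpow_stab: "int p dvd exp_a w \<Longrightarrow> profile (wpow w n) i = int n * profile w i"
  by (simp add: profile_def wsection_wpow_stab)

lemma profile_winv_stab: "int p dvd exp_a w \<Longrightarrow> profile (winv w) i = - profile w i"
  by (simp add: profile_def wsection_winv_stab)

lemma profile_wconj:
  assumes x: "[exp_a x = 1] (mod int p)" and w: "int p dvd exp_a w"
  shows "profile (wconj x j w) i = profile w (i - int j)"
  using wsection_wconj[OF assms, of i j] by (auto simp: profile_def)

lemma exp_c_wsection_wconj:
  assumes x: "[exp_a x = 1] (mod int p)" and w: "int p dvd exp_a w"
    and ab: "int p dvd exp_a (wsection (i - int j) w)" "int p dvd exp_b (wsection (i - int j) w)"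
  shows "[exp_c (wsection i (wconj x j w)) = exp_c (wsection (i - int j) w)] (mod int p)"
proof -
  obtain u where "wsection i (wconj x j w) = u @ wsection (i - int j) w @ winv u"
    using wsection_wconj[OF x w] by blast
  then have "exp_c (wsection i (wconj x j w)) - exp_c (wsection (i - int j) w)
    = exp_a u * exp_b (wsection (i - int j) w) - exp_a (wsection (i - int j) w) * exp_b u"
    by (simp add: algebra_simps)
  then show ?thesis unfolding cong_iff_dvd_diff using ab by simp
qed

lemma profile_moment_word_sum:
  assumes x: "[exp_a x = 1] (mod int p)" and w: "int p dvd exp_a w"
  shows "profile (moment_word x e n w) i = (\<Sum>j<n. int (e j) * profile w (i - int j))"
proof (induction n)
  case (Suc n)
  have "int p dvd exp_a (wconj x n (wpow w (e n)))" using w by simp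
  then show ?case
    using Suc by (simp add: profile_append_stab profile_wconj[OF x] w profile_wpow_stab)
qed simp

text \<open>Reflecting the summation index moves the shift from the profile to the power.\<close>

lemma profile_moment_word:
  assumes x: "[exp_a x = 1] (mod int p)" and w: "int p dvd exp_a w"
  shows "[profile (moment_word x (\<lambda>j. j ^ d) p w) i
    = (\<Sum>l<p. (i - int l) ^ d * profile w (int l))] (mod int p)"
proof -
  let ?f = "\<lambda>l. (i - l) ^ d * profile w l"
  have "periodic ?f"
    by (intro periodic_mult periodic_power periodic_diff periodic_const periodic_id periodic_profile)
  from sum_reflect[OF this, of i] show ?thesis
    by (simp add: profile_moment_word_sum[OF x w])
qed

section \<open>Descending one level of the tree\<close>

text \<open>Convolution with the constant \<open>1\<close> makes the profile constant.\<close>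

lemma norm_word_sections:
  assumes x: "[exp_a x = 1] (mod int p)" and y: "int p dvd exp_a y" "[exp_b y = 1] (mod int p)"
  shows "int p dvd exp_a (wsection i (moment_word x (\<lambda>j. j ^ 0) p y))"
    and "[exp_b (wsection i (moment_word x (\<lambda>j. j ^ 0) p y)) = 1] (mod int p)"
proof -
  have P: "[profile (moment_word x (\<lambda>j. j ^ 0) p y) i = 1] (mod int p)" for i
    using cong_trans[OF profile_moment_word[OF x y(1), of 0 i]] y(2) by (simp add: sum_profile)
  then show "[exp_b (wsection i (moment_word x (\<lambda>j. j ^ 0) p y)) = 1] (mod int p)"
    by (simp add: profile_def)
  show "int p dvd exp_a (wsection i (moment_word x (\<lambda>j. j ^ 0) p y))"
    unfolding exp_a_wsection using cong_diff[OF P P] by (simp add: cong_0_iff)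
qed

text \<open>Convolution with \<open>j\<close> makes the profile affine with slope \<open>exp_b y = 1\<close>, and the \<open>a\<close>-exponents of the
sections are differences of this profile.\<close>

lemma first_moment_word_sections:
  assumes x: "[exp_a x = 1] (mod int p)" and y: "int p dvd exp_a y" "[exp_b y = 1] (mod int p)"
  shows "[exp_a (wsection i (moment_word x (\<lambda>j. j ^ 1) p y)) = 1] (mod int p)"
proof -
  define c where "c = (\<Sum>l<p. int l * profile y (int l))"
  have P: "[profile (moment_word x (\<lambda>j. j ^ 1) p y) i = i - c] (mod int p)" for i
  proof -
    have "(\<Sum>l<p. (i - int l) ^ 1 * profile y (int l)) = i * exp_b y - c"
      unfolding sum_profile[symmetric] c_def
      by (simp add: sum_distrib_left sum_subtractf left_diff_distrib)
    moreover have "[i * exp_b y - c = i * 1 - c] (mod int p)"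
      using y(2) by (intro cong_diff cong_mult cong_refl)
    ultimately show ?thesis
      using cong_trans[OF profile_moment_word[OF x y(1), of 1 i]] by simp
  qed
  show ?thesis
    unfolding exp_a_wsection using cong_diff[OF P[of "i - 1"] P[of "i - 2"]] by simp
qed

text \<open>The quadratic coefficient of \<open>\<Sum>l. (i - l)\<^sup>2 s(l)\<close> is the sum of the profile \<open>s\<close>, which vanishes, and
the linear coefficient is \<open>- 2\<close> times its first moment.\<close>

lemma second_moment_profile:
  assumes x: "[exp_a x = 1] (mod int p)" and z: "int p dvd exp_a z" "int p dvd exp_b z"
  obtains c where "\<And>i. [profile (moment_word x (\<lambda>j. j ^ 2) p z) i = c - 2 * i * exp_c z] (mod int p)"
proof
  let ?M = "\<Sum>l<p. int l * profile z (int l)"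
  let ?c = "\<Sum>l<p. (int l)\<^sup>2 * profile z (int l)"
  have M: "[?M = exp_c z] (mod int p)"
  proof -
    have "[exp_b z * (1 + exp_a z) = 0] (mod int p)" using z by (simp add: cong_0_iff)
    from cong_trans[OF exp_c_profile cong_add[OF cong_refl this]] show ?thesis
      by (simp add: cong_sym_eq)
  qed
  fix i
  have "(i - int l) ^ 2 * profile z (int l)
      = i\<^sup>2 * profile z (int l) - 2 * i * (int l * profile z (int l)) + (int l)\<^sup>2 * profile z (int l)" for l
    by (simp add: power2_eq_square algebra_simps)
  then have eq: "(\<Sum>l<p. (i - int l) ^ 2 * profile z (int l)) = i\<^sup>2 * exp_b z - 2 * i * ?M + ?c"
    unfolding sum_profile[symmetric] by (simp add: sum.distrib sum_subtractf sum_distrib_left)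
  have "[profile (moment_word x (\<lambda>j. j ^ 2) p z) i = i\<^sup>2 * exp_b z - 2 * i * ?M + ?c] (mod int p)"
    using profile_moment_word[OF x z(1), of 2 i] by (simp only: eq)
  also have "[i\<^sup>2 * exp_b z - 2 * i * ?M + ?c = 0 - 2 * i * exp_c z + ?c] (mod int p)"
    using z M by (intro cong_add cong_diff cong_mult cong_refl) (auto simp: cong_0_iff)
  finally show "[profile (moment_word x (\<lambda>j. j ^ 2) p z) i = ?c - 2 * i * exp_c z] (mod int p)"
    by simp
qed

text \<open>Let \<open>u\<close> be the quadratic moment word of \<open>z\<close>, with affine profile of slope \<open>\<sigma> = - 2 exp_c z\<close> and
sections with \<open>a\<close>-exponent \<open>\<sigma>\<close>.  The commutator with \<open>y\<close> has \<open>exp_c\<close> at \<open>i\<close> equal to the determinant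
of the exponents of the sections of \<open>u\<close> and \<open>y\<close>.  Summed over \<open>i\<close>, its first product gives \<open>\<sigma>\<close>;
summation by parts in the second gives another \<open>\<sigma>\<close>.  The total \<open>- 4 exp_c z\<close> is a unit multiple of
\<open>exp_c z\<close> because \<open>p\<close> is odd.\<close>

lemma sum_exp_c_descend:
  assumes x: "[exp_a x = 1] (mod int p)"
    and y: "int p dvd exp_a y" "[exp_b y = 1] (mod int p)"
    and z: "int p dvd exp_a z" "int p dvd exp_b z"
  shows "[(\<Sum>i<p. exp_c (wsection (int i) (wcomm (moment_word x (\<lambda>j. j ^ 2) p z) y))) = - 4 * exp_c z] (mod int p)"
proof -
  let ?u = "moment_word x (\<lambda>j. j ^ 2) p z" and ?k = "exp_c z"
  obtain c where c: "\<And>i. [profile ?u i = c - 2 * i * ?k] (mod int p)"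
    using second_moment_profile[OF x z] by blast
  have u: "int p dvd exp_a ?u" using z by (simp add: exp_a_moment_word)
  let ?s = "profile y"
  let ?f = "\<lambda>d i. ?s i * (c - 2 * (i + d) * ?k)"
  have per: "periodic (?f d)" for d
    by (intro periodic_mult periodic_profile periodic_diff periodic_const periodic_add periodic_id)
  \<comment> \<open>The offsets 1 and 2 in \<open>?f\<close> let the two shifted terms be brought back to a common position.\<close>
  have summand: "[exp_c (wsection i (wcomm ?u y)) = - 2 * ?k * ?s i - ?f 1 (i - 1) + ?f 2 (i - 2)] (mod int p)" for i
  proof -
    have "[profile ?u (i - 1) - profile ?u (i - 2)
        = (c - 2 * (i - 1) * ?k) - (c - 2 * (i - 2) * ?k)] (mod int p)"
      by (intro cong_diff c)
    then have "[(profile ?u (i - 1) - profile ?u (i - 2)) * ?s i - (?s (i - 1) - ?s (i - 2)) * profile ?u i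
       = ((c - 2 * (i - 1) * ?k) - (c - 2 * (i - 2) * ?k)) * ?s i - (?s (i - 1) - ?s (i - 2)) * (c - 2 * i * ?k)] (mod int p)"
      by (intro cong_diff cong_mult c cong_refl)
    also have "((c - 2 * (i - 1) * ?k) - (c - 2 * (i - 2) * ?k)) * ?s i - (?s (i - 1) - ?s (i - 2)) * (c - 2 * i * ?k)
       = - 2 * ?k * ?s i - ?f 1 (i - 1) + ?f 2 (i - 2)"
      by (simp add: algebra_simps)
    also have "(profile ?u (i - 1) - profile ?u (i - 2)) * ?s i - (?s (i - 1) - ?s (i - 2)) * profile ?u i
       = exp_c (wsection i (wcomm ?u y))"
      by (simp add: wsection_wcomm_stab[OF u y(1)] exp_a_wsection profile_def)
    finally show ?thesis .
  qed
  have "[(\<Sum>i<p. exp_c (wsection (int i) (wcomm ?u y)))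
      = (\<Sum>i<p. - 2 * ?k * ?s (int i) - ?f 1 (int i - 1) + ?f 2 (int i - 2))] (mod int p)"
    by (intro cong_sum summand)
  also have "(\<Sum>i<p. - 2 * ?k * ?s (int i) - ?f 1 (int i - 1) + ?f 2 (int i - 2))
      = (\<Sum>i<p. - 2 * ?k * ?s (int i)) - (\<Sum>i<p. ?f 1 (int i - 1)) + (\<Sum>i<p. ?f 2 (int i - 2))"
    by (simp only: sum.distrib sum_subtractf)
  also have "[\<dots> = (\<Sum>i<p. - 2 * ?k * ?s (int i)) - (\<Sum>i<p. ?f 1 (int i)) + (\<Sum>i<p. ?f 2 (int i))] (mod int p)"
    by (intro cong_add cong_diff cong_refl sum_shift' per)
  also have "(\<Sum>i<p. - 2 * ?k * ?s (int i)) - (\<Sum>i<p. ?f 1 (int i)) + (\<Sum>i<p. ?f 2 (int i))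
      = - 4 * ?k * exp_b y"
    unfolding sum_profile[symmetric] sum_subtractf[symmetric] sum.distrib[symmetric] sum_distrib_left
    by (intro sum.cong refl) (simp add: algebra_simps)
  also have "[\<dots> = - 4 * ?k * 1] (mod int p)"
    using y(2) by (intro cong_mult cong_refl)
  finally show ?thesis by simp
qed

text \<open>The section at a vertex of arbitrary level.  It is multiplicative on words that stabilise that level.\<close>

fun vsection :: "nat list \<Rightarrow> word \<Rightarrow> word" where
  "vsection [] w = w"
| "vsection (i # v) w = vsection v (wsection (int i) w)"

fun wstab :: "nat \<Rightarrow> word \<Rightarrow> bool" where
  "wstab 0 w \<longleftrightarrow> True"
| "wstab (Suc m) w \<longleftrightarrow> int p dvd exp_a w \<and> (\<forall>i<p. wstab m (wsection (int i) w))"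

lemma level_words_0 [simp]: "level_words p 0 = {[]}"
  by (auto simp: level_words_def)

lemma Cons_in_level_words [simp]: "i # v \<in> level_words p (Suc m) \<longleftrightarrow> i < p \<and> v \<in> level_words p m"
  by (auto simp: level_words_def)

lemma snoc_in_level_words [simp]: "v @ [i] \<in> level_words p (Suc m) \<longleftrightarrow> i < p \<and> v \<in> level_words p m"
  by (auto simp: level_words_def tree_words_def)

lemma level_words_Suc_cases:
  assumes "v \<in> level_words p (Suc m)"
  obtains i u where "v = i # u" "i < p" "u \<in> level_words p m"
  using assms by (cases v) (auto simp: level_words_def)

lemma level_words_snoc_cases:
  assumes "v \<in> level_words p (Suc m)"
  obtains i u where "v = u @ [i]" "i < p" "u \<in> level_words p m"
  using assms by (cases v rule: rev_cases) (auto simp: level_words_def tree_words_def)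

lemma bij_level_words_snoc:
  "bij_betw (\<lambda>(v, i). v @ [i]) (level_words p m \<times> {..<p}) (level_words p (Suc m))"
  by (rule bij_betw_imageI) (auto simp: inj_on_def elim!: level_words_snoc_cases)

lemma finite_level_words [simp]: "finite (level_words p m)"
  and card_level_words: "card (level_words p m) = p ^ m"
proof (induction m)
  case (Suc m)
  case 1 show ?case
    using bij_betw_finite[OF bij_level_words_snoc[of m]] Suc by simp
  case 2 show ?case
    using bij_betw_same_card[OF bij_level_words_snoc[of m]] Suc
    by (simp add: card_cartesian_product mult.commute)
qed auto

lemma sum_level_words_Suc:
  "(\<Sum>f\<in>level_words p (Suc m). F f) = (\<Sum>f\<in>level_words p m. \<Sum>j<p. F (f @ [j]))"
  using sum.reindex_bij_betw[OF bij_level_words_snoc[of m], of F]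
  by (simp add: sum.cartesian_product case_prod_unfold)

lemma vsection_snoc: "vsection (v @ [i]) w = wsection (int i) (vsection v w)"
  by (induction v arbitrary: w) auto

lemma vsection_append:
  "wstab m w \<Longrightarrow> v \<in> level_words p m \<Longrightarrow> vsection v (u @ w) = vsection v u @ vsection v w"
  by (induction m arbitrary: u w v) (auto simp: wsection_append_stab elim!: level_words_Suc_cases)

lemma vsection_winv:
  "wstab m w \<Longrightarrow> v \<in> level_words p m \<Longrightarrow> vsection v (winv w) = winv (vsection v w)"
  by (induction m arbitrary: w v) (auto simp: wsection_winv_stab elim!: level_words_Suc_cases)

lemma wstab_Nil [simp]: "wstab m []"
  by (induction m) auto

lemma wstab_append: "wstab m u \<Longrightarrow> wstab m w \<Longrightarrow> wstab m (u @ w)"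
  by (induction m arbitrary: u w) (auto simp: wsection_append_stab)

lemma wstab_winv: "wstab m w \<Longrightarrow> wstab m (winv w)"
  by (induction m arbitrary: w) (auto simp: wsection_winv_stab)

lemma wstab_wpow: "wstab m w \<Longrightarrow> wstab m (wpow w n)"
  by (induction n) (auto intro: wstab_append)

lemma wstab_wcomm: "wstab m u \<Longrightarrow> wstab m w \<Longrightarrow> wstab m (wcomm u w)"
  by (auto simp: wcomm_def intro!: wstab_append wstab_winv)

lemma wstab_wconj: "wstab m u \<Longrightarrow> wstab m w \<Longrightarrow> wstab m (wconj u j w)"
  by (auto simp: wconj_def intro!: wstab_append wstab_winv wstab_wpow)

lemma wstab_moment_word: "wstab m u \<Longrightarrow> wstab m w \<Longrightarrow> wstab m (moment_word u e n w)"
  by (induction n) (auto intro!: wstab_append wstab_wconj wstab_wpow)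

lemma vsection_Nil [simp]: "vsection v [] = []"
  by (induction v) auto

context
  fixes m v assumes v: "v \<in> level_words p m"
begin

lemma vsection_wpow: "wstab m w \<Longrightarrow> vsection v (wpow w n) = wpow (vsection v w) n"
  by (induction n) (auto simp: vsection_append[OF wstab_wpow v])

lemma vsection_wcomm:
  "wstab m u \<Longrightarrow> wstab m w \<Longrightarrow> vsection v (wcomm u w) = wcomm (vsection v u) (vsection v w)"
  by (simp add: wcomm_def vsection_append[OF _ v] vsection_winv[OF _ v] wstab_append wstab_winv)

lemma vsection_wconj:
  "wstab m u \<Longrightarrow> wstab m w \<Longrightarrow> vsection v (wconj u j w) = wconj (vsection v u) j (vsection v w)"
  by (simp add: wconj_def vsection_append[OF _ v] vsection_winv[OF _ v] wstab_append wstab_winv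
      wstab_wpow vsection_wpow)

lemma vsection_moment_word:
  "wstab m u \<Longrightarrow> wstab m w \<Longrightarrow>
    vsection v (moment_word u e n w) = moment_word (vsection v u) e n (vsection v w)"
  by (induction n) (simp_all add: vsection_append[OF _ v] wstab_wconj wstab_wpow vsection_wconj vsection_wpow)

end

text \<open>The recursive definition peels off the top level of the tree; this form peels off the bottom level.\<close>

lemma wstab_Suc_right:
  "wstab (Suc m) w \<longleftrightarrow> wstab m w \<and> (\<forall>v\<in>level_words p m. int p dvd exp_a (vsection v w))"
proof (induction m arbitrary: w)
  case (Suc m)
  have "wstab (Suc (Suc m)) w \<longleftrightarrow> int p dvd exp_a w \<and> (\<forall>i<p. wstab (Suc m) (wsection (int i) w))"
    by (rule wstab.simps(2))
  also have "\<dots> \<longleftrightarrow> int p dvd exp_a w \<and> (\<forall>i<p. wstab m (wsection (int i) w) \<and>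
      (\<forall>v\<in>level_words p m. int p dvd exp_a (vsection v (wsection (int i) w))))"
    by (simp only: Suc.IH)
  also have "\<dots> \<longleftrightarrow> wstab (Suc m) w \<and>
      (\<forall>i<p. \<forall>v\<in>level_words p m. int p dvd exp_a (vsection (i # v) w))"
    by (simp only: wstab.simps(2) vsection.simps) blast
  also have "(\<forall>i<p. \<forall>v\<in>level_words p m. int p dvd exp_a (vsection (i # v) w))
      \<longleftrightarrow> (\<forall>v\<in>level_words p (Suc m). int p dvd exp_a (vsection v w))"
    by (metis Cons_in_level_words level_words_Suc_cases)
  finally show ?case .
qed simp

end

section \<open>Word length and frames on every level\<close>

text \<open>The properties of \<open>R k w\<close>, read as: the element given by \<open>w\<close> has length at most \<open>k\<close> in some fixed
generating set.  The relation that always holds is an instance, which is used when only the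
existence of words matters.\<close>

definition word_cost :: "(nat \<Rightarrow> word \<Rightarrow> bool) \<Rightarrow> bool" where
  "word_cost R \<longleftrightarrow> R 0 [] \<and> (\<forall>k l w. R k w \<longrightarrow> k \<le> l \<longrightarrow> R l w) \<and>
    (\<forall>k l u w. R k u \<longrightarrow> R l w \<longrightarrow> R (k + l) (u @ w)) \<and> (\<forall>k w. R k w \<longrightarrow> R k (winv w))"

context
  fixes R assumes R: "word_cost R"
begin

lemma cost_Nil: "R k []"
  using R unfolding word_cost_def by blast

lemma cost_mono: "R k w \<Longrightarrow> k \<le> l \<Longrightarrow> R l w"
  using R unfolding word_cost_def by blast

lemma cost_append: "R k u \<Longrightarrow> R l w \<Longrightarrow> R (k + l) (u @ w)"
  using R unfolding word_cost_def by blast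

lemma cost_winv: "R k w \<Longrightarrow> R k (winv w)"
  using R unfolding word_cost_def by blast

lemma cost_wpow: "R k w \<Longrightarrow> R (n * k) (wpow w n)"
  by (induction n) (auto intro: cost_Nil cost_append)

lemma cost_wcomm:
  assumes "R k u" "R l w"
  shows "R (2 * (k + l)) (wcomm u w)"
proof -
  have "R (k + (l + (k + l))) (u @ w @ winv u @ winv w)"
    by (intro cost_append cost_winv assms)
  moreover have "k + (l + (k + l)) = 2 * (k + l)" by simp
  ultimately show ?thesis by (simp only: wcomm_def)
qed

lemma cost_wconj:
  assumes "R k x" "R l w"
  shows "R (2 * j * k + l) (wconj x j w)"
proof -
  have "R (j * k + (l + j * k)) (wpow x j @ w @ winv (wpow x j))"
    by (intro cost_append cost_winv cost_wpow assms)
  moreover have "j * k + (l + j * k) = 2 * j * k + l" by simp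
  ultimately show ?thesis by (simp only: wconj_def)
qed

lemma cost_moment_word:
  assumes x: "R k x" and w: "R l w"
  shows "R (\<Sum>j<n. 2 * j * k + e j * l) (moment_word x e n w)"
proof (induction n)
  case (Suc n)
  show ?case using cost_append[OF Suc cost_wconj[OF x cost_wpow[OF w]]] by simp
qed (simp add: cost_Nil)

lemma cost_concat:
  assumes "\<And>a. a \<in> set as \<Longrightarrow> R k (F a)"
  shows "R (length as * k) (concat (map F as))"
  using assms
proof (induction as)
  case (Cons a as)
  then have "R (k + length as * k) (F a @ concat (map F as))" by (intro cost_append) auto
  then show ?case by simp
qed (simp add: cost_Nil)

end

lemma sum_linear_plus_square: "6 * (\<Sum>j<n. 2 * j + j ^ 2) + 5 * n = 2 * n ^ 3 + 3 * (n::nat) ^ 2"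
  by (induction n) (auto simp: algebra_simps power2_eq_square power3_eq_cube)

context odd_prime
begin

text \<open>The three lengths that occur when a frame is moved to the next level: those of the new family, of
the new \<open>y\<close> and of the new \<open>x\<close>.  The first is the largest of them.\<close>

lemma level_cost_bounds:
  shows "2 * (p - 1) * L + 2 * ((\<Sum>j<p. 2 * j * L + j ^ 2 * L) + L) \<le> (p ^ 3 + p) * L" (is ?A)
    and "(\<Sum>j<p. 2 * j * L + j ^ 0 * L) \<le> (p ^ 3 + p) * L" (is ?B)
    and "(\<Sum>j<p. 2 * j * L + j ^ 1 * L) \<le> (p ^ 3 + p) * L" (is ?C)
proof -
  let ?S = "\<Sum>j<p. 2 * j + j ^ 2"
  have "3 * p ^ 2 \<le> p ^ 3" using p_ge_3 by (simp add: power2_eq_square power3_eq_cube)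
  then have S: "2 * (p - 1) + 2 * (?S + 1) \<le> p ^ 3 + p"
    using sum_linear_plus_square[of p] p_ge_3 by (simp add: diff_mult_distrib2)
  have fac: "(\<Sum>j<p. 2 * j * L + j ^ d * L) = (\<Sum>j<p. 2 * j + j ^ d) * L" for d
    by (simp add: sum_distrib_right distrib_right)
  have "2 * (p - 1) * L + 2 * (?S * L + L) = (2 * (p - 1) + 2 * (?S + 1)) * L"
    by (simp add: algebra_simps)
  then show ?A unfolding fac using mult_right_mono[OF S, of L] by simp
  have "(\<Sum>j<p. 2 * j + j ^ 1) \<le> ?S"
    by (intro sum_mono) (auto simp: power2_eq_square)
  then show ?C unfolding fac using S by (intro mult_right_mono) auto
  have "(\<Sum>j<p. 2 * j + j ^ 0) \<le> (\<Sum>j<p. 2 * j + j ^ 2) + 1"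
  proof -
    have "(\<Sum>j<p. 2 * j + j ^ 0) \<le> (\<Sum>j<p. 2 * j + j ^ 2 + (if j = 0 then 1 else 0))"
      by (intro sum_mono) auto
    also have "\<dots> = (\<Sum>j<p. 2 * j + j ^ 2) + 1"
      using p_pos by (simp add: sum.distrib)
    finally show ?thesis .
  qed
  then show ?B unfolding fac using S by (intro mult_right_mono) auto
qed

text \<open>The data carried along the levels.  At every vertex of level \<open>m\<close> the sections of \<open>x\<close> and \<open>y\<close> look like
\<open>a\<close> times a power of \<open>b\<close>, and like \<open>b\<close>, modulo derived elements; the sections of all \<open>z f\<close> are derived,
and the \<open>z f\<close> are numerous enough to reach every vector of \<open>exp_c\<close> values.
The family is indexed by the vertices of level \<open>m\<close> only because there are as many of them as are needed.\<close>

definition frame :: "(nat \<Rightarrow> word \<Rightarrow> bool) \<Rightarrow> nat \<Rightarrow> nat \<Rightarrow> word \<Rightarrow> word \<Rightarrow> (nat list \<Rightarrow> word) \<Rightarrow> bool" where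
  "frame R L m x y z \<longleftrightarrow>
    (wstab m x \<and> wstab m y \<and> (\<forall>f\<in>level_words p m. wstab m (z f))) \<and>
    (R L x \<and> R L y \<and> (\<forall>f\<in>level_words p m. R L (z f))) \<and>
    (\<forall>v\<in>level_words p m. [exp_a (vsection v x) = 1] (mod int p) \<and>
      int p dvd exp_a (vsection v y) \<and> [exp_b (vsection v y) = 1] (mod int p)) \<and>
    (\<forall>f\<in>level_words p m. \<forall>v\<in>level_words p m.
      int p dvd exp_a (vsection v (z f)) \<and> int p dvd exp_b (vsection v (z f))) \<and>
    spans_mod (level_words p m) (level_words p m) (\<lambda>f v. exp_c (vsection v (z f)))"

text \<open>On level \<open>0\<close> a single commutator suffices: its \<open>exp_c\<close> is the determinant of the exponents of \<open>x\<close> and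
\<open>y\<close>, which is \<open>1\<close>.\<close>

lemma frame_0:
  assumes R: "R L x" "R L y" "R L (wcomm x y)"
    and x: "[exp_a x = 1] (mod int p)" and y: "int p dvd exp_a y" "[exp_b y = 1] (mod int p)"
  shows "frame R L 0 x y (\<lambda>_. wcomm x y)"
proof -
  have "[exp_a x * exp_b y - exp_a y * exp_b x = 1 * 1 - 0 * exp_b x] (mod int p)"
    using x y by (intro cong_diff cong_mult cong_refl) (auto simp: cong_0_iff)
  then have c: "[exp_a x * exp_b y - exp_a y * exp_b x = 1] (mod int p)" by simp
  have "spans_mod {[]} {[]} (\<lambda>(f::nat list) (v::nat list). exp_c (vsection v (wcomm x y)))"
    unfolding spans_mod_def
  proof (intro allI exI ballI)
    fix \<phi> :: "nat list \<Rightarrow> int" and v :: "nat list" assume "v \<in> {[]}"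
    then show "[(\<Sum>f\<in>{[]}. (\<lambda>f. \<phi> []) f * exp_c (vsection v (wcomm x y))) = \<phi> v] (mod int p)"
      using cong_mult[OF cong_refl c, of "\<phi> []"] by simp
  qed
  then show ?thesis using assms by (simp add: frame_def)
qed

text \<open>The sums over the last letter of the \<open>exp_c\<close> values of the commutators \<open>q f\<close> are \<open>- 4\<close> times the old
values, so they span; conjugation by powers of \<open>x\<close> shifts the last letter, so the conjugates span all
functions on the next level.\<close>

lemma frame_Suc:
  assumes R: "word_cost R" and F: "frame R L m x y z"
  shows "\<exists>x' y' z'. frame R ((p ^ 3 + p) * L) (Suc m) x' y' z'"
proof -
  let ?V = "level_words p m" and ?W = "level_words p (Suc m)"
  have st: "wstab m x" "wstab m y" "\<And>f. f \<in> ?V \<Longrightarrow> wstab m (z f)"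
    and co: "R L x" "R L y" "\<And>f. f \<in> ?V \<Longrightarrow> R L (z f)"
    and X: "\<And>v. v \<in> ?V \<Longrightarrow> [exp_a (vsection v x) = 1] (mod int p)"
    and Y: "\<And>v. v \<in> ?V \<Longrightarrow> int p dvd exp_a (vsection v y)"
      "\<And>v. v \<in> ?V \<Longrightarrow> [exp_b (vsection v y) = 1] (mod int p)"
    and Z: "\<And>f v. f \<in> ?V \<Longrightarrow> v \<in> ?V \<Longrightarrow> int p dvd exp_a (vsection v (z f))"
      "\<And>f v. f \<in> ?V \<Longrightarrow> v \<in> ?V \<Longrightarrow> int p dvd exp_b (vsection v (z f))"
    and span: "spans_mod ?V ?V (\<lambda>f v. exp_c (vsection v (z f)))"
    using F by (simp_all add: frame_def)
  define x' where "x' = moment_word x (\<lambda>j. j ^ 1) p y"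
  define y' where "y' = moment_word x (\<lambda>j. j ^ 0) p y"
  define q where "q f = wcomm (moment_word x (\<lambda>j. j ^ 2) p (z f)) y" for f
  define z' where "z' g = wconj x (last g) (q (butlast g))" for g
  have vx: "vsection v x' = moment_word (vsection v x) (\<lambda>j. j ^ 1) p (vsection v y)"
    and vy: "vsection v y' = moment_word (vsection v x) (\<lambda>j. j ^ 0) p (vsection v y)"
    if "v \<in> ?V" for v
    unfolding x'_def y'_def by (rule vsection_moment_word[OF that st(1,2)])+
  have q_st: "wstab m (q f)" if "f \<in> ?V" for f
    unfolding q_def by (intro wstab_wcomm wstab_moment_word st that)
  have vq: "vsection v (q f)
      = wcomm (moment_word (vsection v x) (\<lambda>j. j ^ 2) p (vsection v (z f))) (vsection v y)"
    if "f \<in> ?V" "v \<in> ?V" for f v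
    unfolding q_def using vsection_wcomm[OF that(2)] vsection_moment_word[OF that(2)] st that
    by (simp add: wstab_moment_word)
  have vz: "vsection v (z' (f @ [j])) = wconj (vsection v x) j (vsection v (q f))"
    if "f \<in> ?V" "v \<in> ?V" for f v j
    unfolding z'_def using vsection_wconj[OF that(2) st(1) q_st[OF that(1)]] by simp
  have q_sec: "exp_a (wsection i (vsection v (q f))) = 0" "exp_b (wsection i (vsection v (q f))) = 0"
    if "f \<in> ?V" "v \<in> ?V" for f v i
    unfolding vq[OF that] using Y(1)[OF that(2)] Z(1)[OF that]
    by (simp_all add: wsection_wcomm_stab exp_a_moment_word)
  have q_a: "exp_a (vsection v (q f)) = 0" if "f \<in> ?V" "v \<in> ?V" for f v
    unfolding vq[OF that] by simp
  let ?h = "\<lambda>f v i. exp_c (wsection i (vsection v (q f)))"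
  have h_per: "\<forall>f\<in>?V. \<forall>v\<in>?V. periodic (?h f v)"
    unfolding periodic_def by (metis wsection_cong cong_refl)
  have h_span: "spans_mod ?V ?V (\<lambda>f v. \<Sum>i<p. ?h f v (int i))"
  proof (rule spans_mod_scale[OF span])
    have "coprime (2::int) (int p)" using odd by simp
    then have "coprime (- (2 * 2)) (int p)"
      by (metis coprime_minus_left_iff coprime_mult_left_iff)
    then show "coprime (- 4) (int p)" by simp
    show "[(\<Sum>i<p. ?h f v (int i)) = - 4 * exp_c (vsection v (z f))] (mod int p)"
      if "f \<in> ?V" "v \<in> ?V" for f v
      unfolding vq[OF that] by (rule sum_exp_c_descend[OF X Y Z]) (use that in auto)
  qed
  have z'_sec: "int p dvd exp_a (vsection g (z' f)) \<and> int p dvd exp_b (vsection g (z' f))"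
    if fg: "f \<in> ?W" "g \<in> ?W" for f g
  proof -
    obtain f' j where f: "f = f' @ [j]" "f' \<in> ?V" using fg(1) by (rule level_words_snoc_cases)
    obtain v i where g: "g = v @ [i]" "v \<in> ?V" using fg(2) by (rule level_words_snoc_cases)
    obtain u where "wsection (int i) (wconj (vsection v x) j (vsection v (q f')))
        = u @ wsection (int i - int j) (vsection v (q f')) @ winv u"
      using wsection_wconj[OF X[OF g(2)], of "vsection v (q f')" "int i" j] q_a[OF f(2) g(2)] by auto
    then show ?thesis using q_sec[OF f(2) g(2)] by (simp add: f g vsection_snoc vz)
  qed
  have z'_span: "spans_mod ?W ?W (\<lambda>f g. exp_c (vsection g (z' f)))"
    unfolding spans_mod_def
  proof
    fix \<phi> :: "nat list \<Rightarrow> int"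
    define \<psi> where "\<psi> v i = \<phi> (v @ [nat (i mod int p)])" for v i
    have "\<forall>v\<in>?V. periodic (\<psi> v)" by (simp add: periodic_def \<psi>_def cong_def)
    from shift_span_everything[OF h_per h_span this]
    show "\<exists>e. \<forall>g\<in>?W. [(\<Sum>f\<in>?W. e f * exp_c (vsection g (z' f))) = \<phi> g] (mod int p)"
    proof (rule shift_spanE)
      fix e assume e: "\<And>v i. v \<in> ?V \<Longrightarrow>
        [(\<Sum>f\<in>?V. \<Sum>j<p. e f (int j) * ?h f v (i - int j)) = \<psi> v i] (mod int p)"
      have "[(\<Sum>f\<in>?W. e (butlast f) (int (last f)) * exp_c (vsection g (z' f))) = \<phi> g] (mod int p)"
        if g: "g \<in> ?W" for g
      proof -
        obtain v i where vi: "g = v @ [i]" "i < p" "v \<in> ?V" using g by (rule level_words_snoc_cases)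
        have "(\<Sum>f\<in>?W. e (butlast f) (int (last f)) * exp_c (vsection g (z' f)))
          = (\<Sum>f\<in>?V. \<Sum>j<p. e f (int j) * exp_c (wsection (int i) (wconj (vsection v x) j (vsection v (q f)))))"
          unfolding sum_level_words_Suc by (simp add: vi(1) vsection_snoc vz[OF _ vi(3)])
        also have "[\<dots> = (\<Sum>f\<in>?V. \<Sum>j<p. e f (int j) * ?h f v (int i - int j))] (mod int p)"
          by (intro cong_sum cong_mult cong_refl exp_c_wsection_wconj X vi)
            (simp_all add: q_a q_sec vi)
        also have "[(\<Sum>f\<in>?V. \<Sum>j<p. e f (int j) * ?h f v (int i - int j)) = \<psi> v (int i)] (mod int p)"
          by (rule e[OF vi(3)])
        also have "\<psi> v (int i) = \<phi> g" using vi by (simp add: \<psi>_def)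
        finally show ?thesis .
      qed
      then show ?thesis by (intro exI[of _ "\<lambda>f. e (butlast f) (int (last f))"] ballI)
    qed
  qed
  have z'_st: "wstab (Suc m) (z' f)" and z'_co: "R ((p ^ 3 + p) * L) (z' f)" if f: "f \<in> ?W" for f
  proof -
    obtain f' j where f': "f = f' @ [j]" "j < p" "f' \<in> ?V" using f by (rule level_words_snoc_cases)
    show "wstab (Suc m) (z' f)"
      unfolding wstab_Suc_right f'(1) using vz[OF f'(3)] q_a[OF f'(3)]
      by (auto simp: z'_def intro!: wstab_wconj st q_st f')
    have "R (2 * j * L + 2 * ((\<Sum>j<p. 2 * j * L + j ^ 2 * L) + L)) (z' f)"
      unfolding z'_def f'(1) q_def last_snoc butlast_snoc
      by (intro cost_wconj[OF R] cost_wcomm[OF R] cost_moment_word[OF R] co f')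
    moreover have "2 * j * L \<le> 2 * (p - 1) * L" using f'(2) by (intro mult_right_mono) auto
    then have "2 * j * L + 2 * ((\<Sum>j<p. 2 * j * L + j ^ 2 * L) + L) \<le> (p ^ 3 + p) * L"
      using level_cost_bounds(1)[of L] by linarith
    ultimately show "R ((p ^ 3 + p) * L) (z' f)" by (rule cost_mono[OF R])
  qed
  have "wstab (Suc m) x'" "wstab (Suc m) y'"
    unfolding wstab_Suc_right using vx vy Y(1) st
    by (auto simp: exp_a_moment_word x'_def[symmetric] y'_def[symmetric])
      (auto simp: x'_def y'_def intro: wstab_moment_word)
  moreover have "R ((p ^ 3 + p) * L) x'"
    unfolding x'_def by (rule cost_mono[OF R cost_moment_word[OF R co(1,2)] level_cost_bounds(3)])
  moreover have "R ((p ^ 3 + p) * L) y'"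
    unfolding y'_def by (rule cost_mono[OF R cost_moment_word[OF R co(1,2)] level_cost_bounds(2)])
  moreover have "[exp_a (vsection g x') = 1] (mod int p) \<and>
      int p dvd exp_a (vsection g y') \<and> [exp_b (vsection g y') = 1] (mod int p)" if g: "g \<in> ?W" for g
  proof -
    obtain v i where vi: "g = v @ [i]" "i < p" "v \<in> ?V" using g by (rule level_words_snoc_cases)
    show ?thesis
      unfolding vi(1) vsection_snoc vx[OF vi(3)] vy[OF vi(3)]
      using first_moment_word_sections[OF X[OF vi(3)] Y(1)[OF vi(3)] Y(2)[OF vi(3)]]
        norm_word_sections[OF X[OF vi(3)] Y(1)[OF vi(3)] Y(2)[OF vi(3)]] by blast
  qed
  ultimately have "frame R ((p ^ 3 + p) * L) (Suc m) x' y' z'"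
    unfolding frame_def using z'_st z'_co z'_sec z'_span by blast
  then show ?thesis by blast
qed

lemma ex_frame:
  assumes R: "word_cost R" and F: "frame R L 0 x y z"
  shows "\<exists>x y z. frame R ((p ^ 3 + p) ^ m * L) m x y z"
proof (induction m)
  case 0
  then show ?case using F by auto
next
  case (Suc m)
  then show ?case using frame_Suc[OF R] by (fastforce simp: mult.assoc)
qed

section \<open>Approximation and independence on every level\<close>

lemma wstab_concat: "(\<And>a. a \<in> set as \<Longrightarrow> wstab m (F a)) \<Longrightarrow> wstab m (concat (map F as))"
  by (induction as) (auto intro: wstab_append)

lemma vsection_concat:
  assumes v: "v \<in> level_words p m"
  shows "(\<And>a. a \<in> set as \<Longrightarrow> wstab m (F a)) \<Longrightarrow>
    vsection v (concat (map F as)) = concat (map (\<lambda>a. vsection v (F a)) as)"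
proof (induction as)
  case (Cons a as)
  then have "wstab m (concat (map F as))" by (intro wstab_concat) auto
  then show ?case using Cons by (simp add: vsection_append[OF _ v])
qed simp

lemma dvd_exp_a_concat:
  "(\<And>a. a \<in> set as \<Longrightarrow> int p dvd exp_a (F a)) \<Longrightarrow> int p dvd exp_a (concat (map F as))"
  and dvd_exp_b_concat:
  "(\<And>a. a \<in> set as \<Longrightarrow> int p dvd exp_b (F a)) \<Longrightarrow> int p dvd exp_b (concat (map F as))"
  by (induction as) auto

lemma profile_concat:
  "(\<And>a. a \<in> set as \<Longrightarrow> int p dvd exp_a (F a)) \<Longrightarrow>
    profile (concat (map F as)) i = (\<Sum>a\<leftarrow>as. profile (F a) i)"
proof (induction as)
  case (Cons a as)
  then have "int p dvd exp_a (concat (map F as))" by (intro dvd_exp_a_concat) auto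
  then show ?case using Cons by (simp add: profile_append_stab)
qed simp

lemma exp_c_concat:
  "(\<And>a. a \<in> set as \<Longrightarrow> int p dvd exp_b (F a)) \<Longrightarrow>
    [exp_c (concat (map F as)) = (\<Sum>a\<leftarrow>as. exp_c (F a))] (mod int p)"
proof (induction as)
  case (Cons a as)
  then have "int p dvd exp_b (concat (map F as))" by (intro dvd_exp_b_concat) auto
  then have "[exp_a (F a) * exp_b (concat (map F as)) = 0] (mod int p)" by (simp add: cong_0_iff)
  from cong_add[OF cong_add[OF cong_refl Cons.IH] this, of "exp_c (F a)"] Cons.prems
  show ?case by simp
qed simp

lemma exp_c_wpow:
  assumes "int p dvd exp_b w"
  shows "[exp_c (wpow w n) = int n * exp_c w] (mod int p)"
proof (induction n)
  case (Suc n)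
  have "[exp_a w * exp_b (wpow w n) = 0] (mod int p)" using assms by (simp add: cong_0_iff)
  from cong_add[OF cong_add[OF cong_refl Suc] this, of "exp_c w"] show ?case
    by (simp add: algebra_simps)
qed simp

text \<open>Summation by parts turns the first moment of the profile, which is \<open>exp_c w\<close>, into a sum of its
antidifference.\<close>

lemma sum_antidifference_profile:
  assumes r: "periodic r" and P: "\<forall>i. [profile w i = diff_op r i] (mod int p)"
    and b: "int p dvd exp_b w"
  shows "[(\<Sum>i<p. r (int i)) = - 1 * exp_c w] (mod int p)"
proof -
  have "[exp_b w * (1 + exp_a w) = 0] (mod int p)" using b by (simp add: cong_0_iff)
  from cong_trans[OF exp_c_profile cong_add[OF cong_refl this]]
  have "[exp_c w = (\<Sum>i<p. int i * profile w (int i))] (mod int p)" by simp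
  also have "[(\<Sum>i<p. int i * profile w (int i)) = (\<Sum>i<p. int i * diff_op r (int i))] (mod int p)"
    using P by (intro cong_sum cong_mult cong_refl) blast
  also have "(\<Sum>i<p. int i * diff_op r (int i))
      = (\<Sum>i<p. int i * r (int i)) - (\<Sum>i<p. (int i - 1 + 1) * r (int i - 1))"
    by (simp add: diff_op_def right_diff_distrib sum_subtractf)
  also have "[(\<Sum>i<p. int i * r (int i)) - (\<Sum>i<p. (int i - 1 + 1) * r (int i - 1))
      = (\<Sum>i<p. int i * r (int i)) - (\<Sum>i<p. (int i + 1) * r (int i))] (mod int p)"
    by (intro cong_diff cong_refl sum_shift'[where f = "\<lambda>i. (i + 1) * r i"]
        periodic_mult periodic_add periodic_id periodic_const r)
  also have "(\<Sum>i<p. int i * r (int i)) - (\<Sum>i<p. (int i + 1) * r (int i)) = - (\<Sum>i<p. r (int i))"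
    by (simp add: sum_subtractf[symmetric] sum_negf[symmetric] algebra_simps)
  finally have "[- exp_c w = - (- (\<Sum>i<p. r (int i)))] (mod int p)"
    by (simp only: cong_minus_minus_iff)
  then show ?thesis by (simp add: cong_sym_eq)
qed

text \<open>The descending chain along which elements are approximated.\<close>

definition level_derived :: "nat \<Rightarrow> word \<Rightarrow> bool" where
  "level_derived m w \<longleftrightarrow> wstab m w \<and>
    (\<forall>v\<in>level_words p m. int p dvd exp_a (vsection v w) \<and> int p dvd exp_b (vsection v w))"

lemma level_derivedD:
  assumes "level_derived m w" shows "wstab m w"
    "\<And>v. v \<in> level_words p m \<Longrightarrow> int p dvd exp_a (vsection v w)"
    "\<And>v. v \<in> level_words p m \<Longrightarrow> int p dvd exp_b (vsection v w)"
  using assms by (auto simp: level_derived_def)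

text \<open>If the profile of a section vanishes, then so do both exponents of all sections one level further down.\<close>

lemma level_derived_SucI:
  assumes w: "wstab m w" "\<And>v. v \<in> level_words p m \<Longrightarrow> int p dvd exp_a (vsection v w)"
    and P: "\<And>v i. v \<in> level_words p m \<Longrightarrow> [profile (vsection v w) i = 0] (mod int p)"
  shows "level_derived (Suc m) w"
  unfolding level_derived_def
proof (intro conjI ballI)
  show "wstab (Suc m) w" unfolding wstab_Suc_right using w by blast
  fix g assume "g \<in> level_words p (Suc m)"
  then obtain v i where g: "g = v @ [i]" "v \<in> level_words p m" by (rule level_words_snoc_cases)
  show "int p dvd exp_a (vsection g w)"
    unfolding g(1) vsection_snoc exp_a_wsection using P[OF g(2)] by (simp add: cong_0_iff)
  show "int p dvd exp_b (vsection g w)"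
    using P[OF g(2)] by (simp add: g(1) vsection_snoc profile_def cong_0_iff)
qed

text \<open>The profiles of the level \<open>m\<close> sections of \<open>w\<close> and of all \<open>z f\<close> have sum zero, hence are differences.
The antidifferences for the \<open>z f\<close> have sums \<open>- exp_c\<close>, which span, so their shifts combine to
the antidifference for \<open>w\<close>; taking differences again, a product of powers of conjugates of the \<open>z f\<close> has
the same profiles as \<open>w\<close>.\<close>

lemma frame_cover:
  assumes R: "word_cost R" and F: "frame R L m x y z" and w: "level_derived m w"
  shows "\<exists>u. R (2 * p ^ (m + 3) * L) u \<and> level_derived (Suc m) (winv u @ w)"
proof -
  let ?V = "level_words p m"
  have st: "wstab m x" "\<And>f. f \<in> ?V \<Longrightarrow> wstab m (z f)"
    and co: "R L x" "\<And>f. f \<in> ?V \<Longrightarrow> R L (z f)"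
    and X: "\<And>v. v \<in> ?V \<Longrightarrow> [exp_a (vsection v x) = 1] (mod int p)"
    and Z: "\<And>f v. f \<in> ?V \<Longrightarrow> v \<in> ?V \<Longrightarrow> int p dvd exp_a (vsection v (z f))"
      "\<And>f v. f \<in> ?V \<Longrightarrow> v \<in> ?V \<Longrightarrow> int p dvd exp_b (vsection v (z f))"
    and span: "spans_mod ?V ?V (\<lambda>f v. exp_c (vsection v (z f)))"
    using F by (simp_all add: frame_def)
  note w = level_derivedD[OF w]
  have anti: "\<exists>r. periodic r \<and> (\<forall>i. [profile u i = diff_op r i] (mod int p))"
    if "int p dvd exp_b u" for u
    by (rule ex_antidifference[OF periodic_profile]) (use that in \<open>simp add: sum_profile cong_0_iff\<close>)
  then obtain anti_fun where anti_fun: "\<And>u. int p dvd exp_b u \<Longrightarrow> periodic (anti_fun u)"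
    "\<And>u. int p dvd exp_b u \<Longrightarrow> \<forall>i. [profile u i = diff_op (anti_fun u) i] (mod int p)"
    by metis
  define r where "r f v = anti_fun (vsection v (z f))" for f v
  define \<rho> where "\<rho> v = anti_fun (vsection v w)" for v
  have r: "periodic (r f v)" "\<forall>i. [profile (vsection v (z f)) i = diff_op (r f v) i] (mod int p)"
    if "f \<in> ?V" "v \<in> ?V" for f v
    unfolding r_def by (rule anti_fun[OF Z(2)[OF that]])+
  have \<rho>: "periodic (\<rho> v)" "\<forall>i. [profile (vsection v w) i = diff_op (\<rho> v) i] (mod int p)"
    if "v \<in> ?V" for v
    unfolding \<rho>_def by (rule anti_fun[OF w(3)[OF that]])+
  have "spans_mod ?V ?V (\<lambda>f v. \<Sum>i<p. r f v (int i))"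
    by (rule spans_mod_scale[OF span, of "- 1"])
      (auto intro: sum_antidifference_profile[OF r Z(2), simplified])
  moreover have "\<forall>f\<in>?V. \<forall>v\<in>?V. periodic (r f v)" "\<forall>v\<in>?V. periodic (\<rho> v)"
    using r \<rho> by blast+
  ultimately have "shift_span ?V ?V r \<rho>" by (intro shift_span_everything)
  then show ?thesis
  proof (rule shift_spanE)
    fix e assume e: "\<And>v i. v \<in> ?V \<Longrightarrow>
        [(\<Sum>f\<in>?V. \<Sum>j<p. e f (int j) * r f v (i - int j)) = \<rho> v i] (mod int p)"
    \<comment> \<open>Reducing the coefficients modulo \<open>p\<close> bounds the powers that are needed.\<close>
    define E where "E f j = nat (e f (int j) mod int p)" for f j
    have E: "[int (E f j) = e f (int j)] (mod int p)" "E f j \<le> p" for f j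
      using p_pos by (auto simp: E_def cong_def nat_le_iff intro!: less_imp_le)
    obtain fs where fs: "set fs = ?V" "distinct fs"
      using finite_distinct_list[OF finite_level_words] by blast
    define t where "t a = wpow (wconj x (snd a) (z (fst a))) (E (fst a) (snd a))" for a
    define as where "as = List.product fs [0..<p]"
    have as: "set as = ?V \<times> {..<p}" "distinct as" "length as = p ^ m * p"
      using fs distinct_card[OF fs(2)]
      by (auto simp: as_def distinct_product card_level_words length_product)
    define u where "u = concat (map t as)"
    have t_st: "wstab m (t a)" if "a \<in> set as" for a
      using that unfolding as t_def by (auto intro!: wstab_wpow wstab_wconj st)
    have t_vs: "vsection v (t (f, j)) = wpow (wconj (vsection v x) j (vsection v (z f))) (E f j)"
      if "f \<in> ?V" "v \<in> ?V" for f j v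
      using that st by (simp add: t_def vsection_wpow vsection_wconj wstab_wconj)
    have t_a: "int p dvd exp_a (vsection v (t a))" if "a \<in> set as" "v \<in> ?V" for a v
      using that Z(1) unfolding as by (auto simp: t_vs)
    have u_st: "wstab m u" unfolding u_def by (rule wstab_concat[OF t_st])
    have u_vs: "vsection v u = concat (map (\<lambda>a. vsection v (t a)) as)" if "v \<in> ?V" for v
      unfolding u_def by (rule vsection_concat[OF that t_st])
    have u_a: "int p dvd exp_a (vsection v u)" if "v \<in> ?V" for v
      unfolding u_vs[OF that] by (rule dvd_exp_a_concat[OF t_a[OF _ that]])
    have u_P: "[profile (vsection v u) i = profile (vsection v w) i] (mod int p)" if v: "v \<in> ?V" for v i
    proof -
      have "profile (vsection v u) i = (\<Sum>a\<leftarrow>as. profile (vsection v (t a)) i)"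
        unfolding u_vs[OF v] by (rule profile_concat[OF t_a[OF _ v]])
      also have "\<dots> = (\<Sum>a\<in>?V \<times> {..<p}. profile (vsection v (t a)) i)"
        using as by (simp add: sum_list_distinct_conv_sum_set)
      also have "\<dots> = (\<Sum>f\<in>?V. \<Sum>j<p. profile (vsection v (t (f, j))) i)"
        by (simp add: sum.cartesian_product)
      also have "\<dots> = (\<Sum>f\<in>?V. \<Sum>j<p. int (E f j) * profile (vsection v (z f)) (i - int j))"
        using v Z(1) by (intro sum.cong refl) (simp add: t_vs profile_wpow_stab profile_wconj X)
      also have "[(\<Sum>f\<in>?V. \<Sum>j<p. int (E f j) * profile (vsection v (z f)) (i - int j))
        = (\<Sum>f\<in>?V. \<Sum>j<p. e f (int j) * diff_op (r f v) (i - int j))] (mod int p)"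
        using r(2) v by (intro cong_sum cong_mult E) auto
      also have "(\<Sum>f\<in>?V. \<Sum>j<p. e f (int j) * diff_op (r f v) (i - int j))
        = (\<Sum>f\<in>?V. \<Sum>j<p. e f (int j) * r f v (i - int j))
          - (\<Sum>f\<in>?V. \<Sum>j<p. e f (int j) * r f v ((i - 1) - int j))"
        by (simp add: diff_op_def sum_subtractf[symmetric] algebra_simps)
      also have "[(\<Sum>f\<in>?V. \<Sum>j<p. e f (int j) * r f v (i - int j))
          - (\<Sum>f\<in>?V. \<Sum>j<p. e f (int j) * r f v ((i - 1) - int j))
        = \<rho> v i - \<rho> v (i - 1)] (mod int p)"
        by (intro cong_diff e v)
      also have "\<rho> v i - \<rho> v (i - 1) = diff_op (\<rho> v) i" by (simp add: diff_op_def)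
      also have "[diff_op (\<rho> v) i = profile (vsection v w) i] (mod int p)"
        using \<rho>(2)[OF v] by (simp add: cong_sym_eq)
      finally show ?thesis .
    qed
    have "level_derived (Suc m) (winv u @ w)"
    proof (rule level_derived_SucI)
      show "wstab m (winv u @ w)" by (intro wstab_append wstab_winv u_st w)
      fix v assume v: "v \<in> ?V"
      have vs: "vsection v (winv u @ w) = winv (vsection v u) @ vsection v w"
        by (simp add: vsection_append[OF w(1) v] vsection_winv[OF u_st v])
      show "int p dvd exp_a (vsection v (winv u @ w))"
        unfolding vs using u_a[OF v] w(2)[OF v] by simp
      show "[profile (vsection v (winv u @ w)) i = 0] (mod int p)" for i
        unfolding vs using cong_diff[OF cong_sym[OF u_P[OF v, of i]] cong_refl] u_a[OF v] w(2)[OF v] u_P[OF v, of i]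
        by (simp add: profile_append_stab profile_winv_stab cong_iff_dvd_diff dvd_diff_commute)
    qed
    moreover have "R (length as * (p * (2 * p * L))) u"
      unfolding u_def
    proof (rule cost_concat[OF R])
      fix a assume "a \<in> set as"
      then have a: "fst a \<in> ?V" "snd a < p" unfolding as by auto
      have "R (E (fst a) (snd a) * (2 * snd a * L + L)) (t a)"
        unfolding t_def by (intro cost_wpow[OF R] cost_wconj[OF R] co a)
      moreover have "2 * snd a * L + L \<le> 2 * p * L"
      proof -
        have "2 * snd a + 1 \<le> 2 * p" using a(2) by simp
        then have "(2 * snd a + 1) * L \<le> 2 * p * L" by (rule mult_right_mono) simp
        then show ?thesis by (simp add: algebra_simps)
      qed
      then have "E (fst a) (snd a) * (2 * snd a * L + L) \<le> p * (2 * p * L)"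
        by (intro mult_mono E) auto
      ultimately show "R (p * (2 * p * L)) (t a)" by (rule cost_mono[OF R])
    qed
    moreover have "length as * (p * (2 * p * L)) = 2 * p ^ (m + 3) * L"
      by (simp add: as(3) power_add power3_eq_cube)
    ultimately show ?thesis by metis
  qed
qed

lemma approximate_by_frames:
  assumes R: "word_cost R" and F: "frame R L 0 x y z" and w: "level_derived 0 w"
  shows "\<exists>u. R (\<Sum>m<n. 2 * p ^ (m + 3) * ((p ^ 3 + p) ^ m * L)) u \<and> level_derived n (winv u @ w)"
proof (induction n)
  case 0
  show ?case using w by (intro exI[of _ "[]"]) (simp add: cost_Nil[OF R])
next
  case (Suc n)
  then obtain u where u: "R (\<Sum>m<n. 2 * p ^ (m + 3) * ((p ^ 3 + p) ^ m * L)) u" "level_derived n (winv u @ w)"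
    by blast
  obtain x y z where "frame R ((p ^ 3 + p) ^ n * L) n x y z" using ex_frame[OF R F] by blast
  from frame_cover[OF R this u(2)] obtain u' where
    u': "R (2 * p ^ (n + 3) * ((p ^ 3 + p) ^ n * L)) u'" "level_derived (Suc n) (winv u' @ winv u @ w)"
    by blast
  show ?case
    using cost_append[OF R u(1) u'(1)] u'(2) by (intro exI[of _ "u @ u'"]) simp
qed

lemma independent_words:
  assumes F: "frame R L m x y z"
  shows "\<exists>u. level_derived m u \<and> (\<forall>v\<in>level_words p m. [exp_c (vsection v u) = \<phi> v] (mod int p))"
proof -
  let ?V = "level_words p m"
  have st: "\<And>f. f \<in> ?V \<Longrightarrow> wstab m (z f)"
    and Z: "\<And>f v. f \<in> ?V \<Longrightarrow> v \<in> ?V \<Longrightarrow> int p dvd exp_a (vsection v (z f))"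
      "\<And>f v. f \<in> ?V \<Longrightarrow> v \<in> ?V \<Longrightarrow> int p dvd exp_b (vsection v (z f))"
    and span: "spans_mod ?V ?V (\<lambda>f v. exp_c (vsection v (z f)))"
    using F by (simp_all add: frame_def)
  from spec[OF span[unfolded spans_mod_def], of \<phi>] obtain e where
    e: "\<forall>v\<in>?V. [(\<Sum>f\<in>?V. e f * exp_c (vsection v (z f))) = \<phi> v] (mod int p)" ..
  define E where "E f = nat (e f mod int p)" for f
  have E: "[int (E f) = e f] (mod int p)" for f
    using p_pos by (auto simp: E_def cong_def)
  obtain fs where fs: "set fs = ?V" "distinct fs"
    using finite_distinct_list[OF finite_level_words] by blast
  define u where "u = concat (map (\<lambda>f. wpow (z f) (E f)) fs)"
  have u_st: "wstab m u" unfolding u_def by (rule wstab_concat) (auto simp: fs intro!: wstab_wpow st)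
  have vs: "vsection v u = concat (map (\<lambda>f. wpow (vsection v (z f)) (E f)) fs)" if v: "v \<in> ?V" for v
  proof -
    have "vsection v u = concat (map (\<lambda>f. vsection v (wpow (z f) (E f))) fs)"
      unfolding u_def by (rule vsection_concat[OF v]) (auto simp: fs intro!: wstab_wpow st)
    also have "map (\<lambda>f. vsection v (wpow (z f) (E f))) fs = map (\<lambda>f. wpow (vsection v (z f)) (E f)) fs"
      by (rule map_cong[OF refl]) (simp add: fs vsection_wpow[OF v st])
    finally show ?thesis .
  qed
  have "level_derived m u"
    unfolding level_derived_def using u_st Z
    by (auto simp: vs fs intro!: dvd_exp_a_concat dvd_exp_b_concat)
  moreover have "[exp_c (vsection v u) = \<phi> v] (mod int p)" if v: "v \<in> ?V" for v
  proof -
    have "[exp_c (vsection v u) = (\<Sum>f\<leftarrow>fs. exp_c (wpow (vsection v (z f)) (E f)))] (mod int p)"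
      unfolding vs[OF v] using Z v by (intro exp_c_concat) (auto simp: fs)
    also have "(\<Sum>f\<leftarrow>fs. exp_c (wpow (vsection v (z f)) (E f)))
        = (\<Sum>f\<in>?V. exp_c (wpow (vsection v (z f)) (E f)))"
      using fs by (simp add: sum_list_distinct_conv_sum_set)
    also have "[(\<Sum>f\<in>?V. exp_c (wpow (vsection v (z f)) (E f)))
        = (\<Sum>f\<in>?V. int (E f) * exp_c (vsection v (z f)))] (mod int p)"
      using Z v by (intro cong_sum exp_c_wpow) auto
    also have "[(\<Sum>f\<in>?V. int (E f) * exp_c (vsection v (z f)))
        = (\<Sum>f\<in>?V. e f * exp_c (vsection v (z f)))] (mod int p)"
      by (intro cong_sum cong_mult cong_refl E)
    also have "[(\<Sum>f\<in>?V. e f * exp_c (vsection v (z f))) = \<phi> v] (mod int p)"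
      using e v by blast
    finally show ?thesis .
  qed
  ultimately show ?thesis by blast
qed

lemma wstab_vsection:
  "wstab (m + k) w \<Longrightarrow> v \<in> level_words p m \<Longrightarrow> wstab k (vsection v w)"
  by (induction m arbitrary: w v) (auto elim!: level_words_Suc_cases)

text \<open>If \<open>w\<close> acts trivially on two levels, then the \<open>a\<close>-exponents of its sections vanish.
These are differences of the profile, which is therefore constant; its sum is a multiple of \<open>p\<close>, and so
is its first moment because \<open>0 + 1 + \<dots> + (p - 1)\<close> is.\<close>

lemma wstab_2_trivial_exponents:
  assumes w: "wstab 2 w"
  shows "int p dvd exp_a w" "int p dvd exp_b w" "int p dvd exp_c w"
proof -
  have w': "int p dvd exp_a w" "\<And>i. i < p \<Longrightarrow> int p dvd exp_a (wsection (int i) w)"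
    using w by (auto simp: numeral_2_eq_2)
  have sec: "int p dvd exp_a (wsection i w)" for i
    using w'(2)[of "nat (i mod int p)"] p_pos by (simp add: nat_less_iff)
  have const: "[profile w (int i) = profile w 0] (mod int p)" for i
  proof (induction i)
    case (Suc i)
    have "[profile w (int (Suc i)) = profile w (int i)] (mod int p)"
      using sec[of "int i + 2"] by (simp add: exp_a_wsection cong_iff_dvd_diff add.commute)
    then show ?case using Suc by (rule cong_trans)
  qed simp
  have "[exp_b w = (\<Sum>i<p. profile w 0)] (mod int p)"
    unfolding sum_profile[symmetric] by (intro cong_sum const)
  then have b: "[exp_b w = 0] (mod int p)" by (simp add: cong_def)
  then show "int p dvd exp_b w" by (simp add: cong_0_iff)
  have "[(\<Sum>i<p. - int i) = (\<Sum>i<p. int i)] (mod int p)"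
    using sum_reflect[OF periodic_id, of 0] by simp
  then have "[- (\<Sum>i<p. int i) + (\<Sum>i<p. int i) = (\<Sum>i<p. int i) + (\<Sum>i<p. int i)] (mod int p)"
    by (intro cong_add cong_refl) (simp add: sum_negf)
  then have "int p dvd 2 * (\<Sum>i<p. int i)"
    by (simp add: cong_sym_eq[of 0] cong_0_iff)
  then have tri: "int p dvd (\<Sum>i<p. int i)"
    using odd by (simp add: coprime_dvd_mult_right_iff)
  have "[exp_c w = (\<Sum>i<p. int i * profile w (int i)) + exp_b w * (1 + exp_a w)] (mod int p)"
    by (rule exp_c_profile)
  also have "[(\<Sum>i<p. int i * profile w (int i)) + exp_b w * (1 + exp_a w)
      = (\<Sum>i<p. int i * profile w 0) + 0 * (1 + exp_a w)] (mod int p)"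
    using b by (intro cong_add cong_sum cong_mult cong_refl const)
  also have "(\<Sum>i<p. int i * profile w 0) + 0 * (1 + exp_a w) = (\<Sum>i<p. int i) * profile w 0"
    by (simp add: sum_distrib_right)
  also have "[(\<Sum>i<p. int i) * profile w 0 = 0] (mod int p)" using tri by (simp add: cong_0_iff)
  finally show "int p dvd exp_c w" by (simp add: cong_0_iff)
  show "int p dvd exp_a w" by fact
qed

section \<open>The action of words on the tree\<close>

text \<open>The action of words on vertices, defined from exponents and sections alone; it agrees with
the evaluation of words in the group of tree automorphisms.\<close>

fun act :: "word \<Rightarrow> nat list \<Rightarrow> nat list" where
  "act w [] = []"
| "act w (i # v) = nat ((int i + exp_a w) mod int p) # act (wsection (int i) w) v"

lemma act_append: "act (u @ w) v = act u (act w v)"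
proof (induction v arbitrary: u w)
  case (Cons i v)
  have "int (nat ((int i + exp_a w) mod int p)) = (int i + exp_a w) mod int p"
    using p_pos by simp
  then show ?case
    by (simp add: Cons wsection_append mod_simps ac_simps del: of_nat_nat)
qed simp

lemma act_in_tree_words: "v \<in> tree_words p \<Longrightarrow> act w v \<in> tree_words p"
  using p_pos by (induction v arbitrary: w) (auto simp: nat_less_iff)

lemma act_Nil: "v \<in> tree_words p \<Longrightarrow> act [] v = v"
  by (induction v) auto

lemma act_winv: "v \<in> tree_words p \<Longrightarrow> act (winv w) (act w v) = v"
proof (induction v arbitrary: w)
  case (Cons i v)
  have "act (winv w) (act w (i # v)) = act (winv w @ w) (i # v)"
    by (simp only: act_append)
  also have "\<dots> = i # act (winv (wsection (int i) w) @ wsection (int i) w) v"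
    using Cons.prems by (simp add: wsection_append wsection_winv)
  also have "\<dots> = i # v" using Cons by (simp add: act_append)
  finally show ?case .
qed simp

lemma prefix_act_iff:
  "u \<in> tree_words p \<Longrightarrow> v \<in> tree_words p \<Longrightarrow> prefix (act w u) (act w v) \<longleftrightarrow> prefix u v"
proof (induction u arbitrary: v w)
  case (Cons i u)
  show ?case
  proof (cases v)
    case (Cons j v')
    have "i = j" if "nat ((int i + exp_a w) mod int p) = nat ((int j + exp_a w) mod int p)"
    proof -
      have "[int i + exp_a w = int j + exp_a w] (mod int p)"
        using that p_pos by (simp add: cong_def eq_nat_nat_iff)
      then have "[int i = int j] (mod int p)" by (simp add: cong_add_rcancel)
      then show ?thesis using Cons.prems \<open>v = j # v'\<close> by (simp add: cong_def)
    qed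
    then show ?thesis using Cons.IH Cons.prems \<open>v = j # v'\<close> by auto
  qed simp
qed simp

lemma wstab_iff_act: "wstab n w \<longleftrightarrow> (\<forall>v\<in>level_words p n. act w v = v)"
proof (induction n arbitrary: w)
  case (Suc n)
  have fix_letter: "nat ((int i + exp_a w) mod int p) = i \<longleftrightarrow> int p dvd exp_a w" if "i < p" for i
  proof -
    have "nat ((int i + exp_a w) mod int p) = i \<longleftrightarrow> (int i + exp_a w) mod int p = int i mod int p"
      using p_pos that nat_eq_iff[of "(int i + exp_a w) mod int p" i]
        pos_mod_sign[of "int p" "int i + exp_a w"] by auto
    also have "\<dots> \<longleftrightarrow> [int i + exp_a w = int i] (mod int p)" by (simp add: cong_def)
    finally show ?thesis by (simp add: cong_iff_dvd_diff)
  qed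
  have ne: "replicate n 0 \<in> level_words p n"
    using p_pos by (auto simp: level_words_def tree_words_def)
  have "(\<forall>v\<in>level_words p (Suc n). act w v = v)
      \<longleftrightarrow> (\<forall>i<p. \<forall>v\<in>level_words p n. act w (i # v) = i # v)"
    by (metis Cons_in_level_words level_words_Suc_cases)
  also have "\<dots> \<longleftrightarrow> (\<forall>i<p. \<forall>v\<in>level_words p n. int p dvd exp_a w \<and> act (wsection (int i) w) v = v)"
    using fix_letter by auto
  also have "\<dots> \<longleftrightarrow> int p dvd exp_a w \<and> (\<forall>i<p. \<forall>v\<in>level_words p n. act (wsection (int i) w) v = v)"
    using ne p_pos by blast
  finally show ?case by (simp add: Suc)
qed simp

definition evalw :: "word \<Rightarrow> nat list \<Rightarrow> nat list" where
  "evalw w = restrict (act w) (tree_words p)"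

lemma evalw_in_tree_aut: "evalw w \<in> carrier (tree_aut p)"
proof -
  have "bij_betw (act w) (tree_words p) (tree_words p)"
    by (rule bij_betw_byWitness[where f' = "act (winv w)"])
      (use act_winv[of _ w] act_winv[of _ "winv w"] act_in_tree_words in auto)
  then show ?thesis
    using prefix_act_iff by (auto simp: tree_aut_def evalw_def Bij_def)
qed

lemma evalw_append: "evalw (u @ w) = evalw u \<otimes>\<^bsub>tree_aut p\<^esub> evalw w"
proof -
  have "evalw u \<in> Bij (tree_words p)" "evalw w \<in> Bij (tree_words p)"
    using evalw_in_tree_aut by (auto simp: tree_aut_def)
  then show ?thesis
    using act_in_tree_words
    by (auto simp: tree_aut_def BijGroup_def compose_def evalw_def act_append fun_eq_iff)
qed

lemma evalw_Nil: "evalw [] = \<one>\<^bsub>tree_aut p\<^esub>"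
  by (auto simp: tree_aut_def BijGroup_def evalw_def act_Nil fun_eq_iff)

lemma evalw_winv: "evalw (winv w) = inv\<^bsub>tree_aut p\<^esub> evalw w"
proof -
  interpret group "tree_aut p" by (rule group_tree_aut)
  have "evalw (winv w) \<otimes>\<^bsub>tree_aut p\<^esub> evalw w = \<one>\<^bsub>tree_aut p\<^esub>"
    unfolding evalw_append[symmetric] evalw_Nil[symmetric]
    by (auto simp: evalw_def act_append act_winv act_Nil fun_eq_iff)
  then show ?thesis
    using inv_equality evalw_in_tree_aut by metis
qed

lemma gs_a_eq_evalw: "gs_a p = evalw [A True]"
proof -
  have "gs_a_word p v = act [A True] v" if "v \<in> tree_words p" for v
    using that
  proof (cases v)
    case (Cons i u)
    have "nat ((int i + 1) mod int p) = (if i = p - 1 then 0 else i + 1)"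
    proof (cases "i = p - 1")
      case True
      then have "int i + 1 = int p" using p_pos by simp
      then show ?thesis using True by simp
    next
      case False
      moreover have "i < p" using that Cons by simp
      ultimately have "int i + 1 < int p" by linarith
      then show ?thesis using False by (simp add: nat_add_distrib)
    qed
    then show ?thesis using Cons that by (simp add: act_Nil)
  qed simp
  then show ?thesis by (auto simp: gs_a_def evalw_def fun_eq_iff)
qed

lemma inv_gs_a_eq_evalw: "inv\<^bsub>tree_aut p\<^esub> gs_a p = evalw [A False]"
  using evalw_winv[of "[A True]"] by (simp add: gs_a_eq_evalw)

lemma gs_b_eq_evalw: "gs_b p = evalw [B True]"
proof -
  have "v \<in> tree_words p \<Longrightarrow> gs_b_word p v = act [B True] v" for v
  proof (induction v)
    case (Cons i v)
    have i: "i < p" using Cons.prems by simp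
    have d0: "int p dvd int i \<longleftrightarrow> i = 0" using i by (auto dest: zdvd_imp_le)
    have d1: "int p dvd int i - 1 \<longleftrightarrow> i = 1"
    proof
      assume "int p dvd int i - 1"
      moreover have "int i - 1 < int p" "- int p < int i - 1" using i p_ge_3 by auto
      ultimately have "int i - 1 = 0" using dvd_imp_le_int[of "int i - 1" "int p"] by fastforce
      then show "i = 1" by simp
    qed simp
    have d2: "int p dvd int i + 1 \<longleftrightarrow> i = p - 1"
    proof
      assume "int p dvd int i + 1"
      then have "int p \<le> int i + 1" by (rule zdvd_imp_le) simp
      then show "i = p - 1" using i by simp
    next
      assume "i = p - 1"
      then have "int i + 1 = int p" using p_pos by simp
      then show "int p dvd int i + 1" by simp
    qed
    have v: "v \<in> tree_words p" using Cons.prems by simp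
    have sec: "wsection (int i) [B True] = (if i = 0 then [A True] else if i = 1 then [A False]
        else if i = p - 1 then [B True] else [])"
      using d0 d1 d2 by simp
    have "gs_a p v = act [A True] v" "(inv\<^bsub>tree_aut p\<^esub> gs_a p) v = act [A False] v"
      using v by (simp_all only: inv_gs_a_eq_evalw) (simp_all add: gs_a_eq_evalw evalw_def)
    then have "(if i = 0 then gs_a p v else if i = 1 then (inv\<^bsub>tree_aut p\<^esub> gs_a p) v
        else if i = p - 1 then gs_b_word p v else v) = act (wsection (int i) [B True]) v"
      unfolding sec using Cons.IH[OF v] act_Nil[OF v] by presburger
    moreover have "nat ((int i + exp_a [B True]) mod int p) = i" using i by simp
    ultimately show ?case by (simp only: gs_b_word.simps act.simps)
  qed simp
  then show ?thesis by (auto simp: gs_b_def evalw_def fun_eq_iff)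
qed

lemma inv_gs_b_eq_evalw: "inv\<^bsub>tree_aut p\<^esub> gs_b p = evalw [B False]"
  using evalw_winv[of "[B True]"] by (simp add: gs_b_eq_evalw)

lemma carrier_gupta_sidki: "carrier (gupta_sidki p) = range evalw"
proof
  have "g \<in> range evalw" if "g \<in> generate (tree_aut p) {gs_a p, gs_b p}" for g
    using that
  proof induction
    case one
    show ?case using evalw_Nil by (metis rangeI)
  next
    case (incl h)
    then show ?case using gs_a_eq_evalw gs_b_eq_evalw by auto
  next
    case (inv h)
    then show ?case using inv_gs_a_eq_evalw inv_gs_b_eq_evalw by auto
  next
    case (eng h1 h2)
    then obtain u w where "h1 = evalw u" "h2 = evalw w" by blast
    then show ?case using evalw_append[of u w] by (metis rangeI)
  qed
  then show "carrier (gupta_sidki p) \<subseteq> range evalw" by (auto simp: gupta_sidki_def)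
  have letter: "evalw [l] \<in> generate (tree_aut p) {gs_a p, gs_b p}" for l
  proof (cases l)
    case (A e)
    then show ?thesis
      using generate.incl[of "gs_a p" "{gs_a p, gs_b p}" "tree_aut p"]
        generate.inv[of "gs_a p" "{gs_a p, gs_b p}" "tree_aut p"]
      by (cases e) (auto simp: gs_a_eq_evalw[symmetric] inv_gs_a_eq_evalw[symmetric])
  next
    case (B e)
    then show ?thesis
      using generate.incl[of "gs_b p" "{gs_a p, gs_b p}" "tree_aut p"]
        generate.inv[of "gs_b p" "{gs_a p, gs_b p}" "tree_aut p"]
      by (cases e) (auto simp: gs_b_eq_evalw[symmetric] inv_gs_b_eq_evalw[symmetric])
  qed
  have "evalw w \<in> generate (tree_aut p) {gs_a p, gs_b p}" for w
  proof (induction w)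
    case Nil
    show ?case using generate.one by (simp add: evalw_Nil)
  next
    case (Cons l w)
    then show ?case using generate.eng[OF letter Cons] evalw_append[of "[l]" w] by simp
  qed
  then show "range evalw \<subseteq> carrier (gupta_sidki p)" by (auto simp: gupta_sidki_def)
qed

lemma mult_gupta_sidki: "evalw u \<otimes>\<^bsub>gupta_sidki p\<^esub> evalw w = evalw (u @ w)"
  by (simp add: gupta_sidki_def evalw_append)

lemma one_gupta_sidki: "\<one>\<^bsub>gupta_sidki p\<^esub> = evalw []"
  by (simp add: gupta_sidki_def evalw_Nil)

lemma inv_gupta_sidki: "inv\<^bsub>gupta_sidki p\<^esub> evalw w = evalw (winv w)"
proof -
  interpret group "gupta_sidki p" by (rule group_gupta_sidki[OF p_pos])
  have "evalw (winv w) \<otimes>\<^bsub>gupta_sidki p\<^esub> evalw w = \<one>\<^bsub>gupta_sidki p\<^esub>"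
    unfolding mult_gupta_sidki one_gupta_sidki
    by (auto simp: evalw_def act_append act_winv act_Nil fun_eq_iff)
  then show ?thesis
    using inv_equality by (simp add: carrier_gupta_sidki)
qed

lemma evalw_in_gs_stab: "evalw w \<in> gs_stab p n \<longleftrightarrow> wstab n w"
proof -
  have "evalw w \<in> gs_stab p n \<longleftrightarrow> restrict (evalw w) (level_words p n) = (\<lambda>v\<in>level_words p n. v)"
    using evalw_in_tree_aut[of w]
    by (auto simp: gs_stab_def carrier_gupta_sidki level_stab_def kernel_def BijGroup_def)
  also have "\<dots> \<longleftrightarrow> (\<forall>v\<in>level_words p n. act w v = v)"
    by (auto simp: fun_eq_iff evalw_def level_words_def restrict_def)
  finally show ?thesis by (simp add: wstab_iff_act)
qed

text \<open>The two exponents are well defined on the group, although the same element is given by many words.\<close>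

lemma evalw_eq_imp_exponents:
  assumes "evalw u = evalw w"
  shows "[exp_a u = exp_a w] (mod int p)" "[exp_b u = exp_b w] (mod int p)"
proof -
  have "act (winv u @ w) v = v" if "v \<in> tree_words p" for v
  proof -
    have "act w v = act u v" using assms that by (metis evalw_def restrict_apply')
    then show ?thesis using that by (simp add: act_append act_winv)
  qed
  then have "wstab 2 (winv u @ w)" unfolding wstab_iff_act by (auto simp: level_words_def)
  from wstab_2_trivial_exponents(1,2)[OF this]
  show "[exp_a u = exp_a w] (mod int p)" "[exp_b u = exp_b w] (mod int p)"
    by (simp_all add: cong_iff_dvd_diff dvd_diff_commute)
qed

end

section \<open>Word balls and diameters of quotients\<close>

lemma word_ball_mono: "k \<le> l \<Longrightarrow> word_ball G S k \<subseteq> word_ball G S l"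
  unfolding word_ball_def by (blast intro: le_trans)

context group
begin

lemma set_inv_closed: "S \<subseteq> carrier G \<Longrightarrow> S \<union> set_inv S \<subseteq> carrier G"
  by (auto simp: SET_INV_def)

lemma foldr_mult_closed: "set xs \<subseteq> carrier G \<Longrightarrow> foldr (\<otimes>) xs \<one> \<in> carrier G"
  by (induction xs) auto

lemma word_ball_subset: "S \<subseteq> carrier G \<Longrightarrow> word_ball G S n \<subseteq> carrier G"
  unfolding word_ball_def using foldr_mult_closed set_inv_closed by blast

lemma one_in_word_ball: "\<one> \<in> word_ball G S n"
  unfolding word_ball_def by (intro CollectI exI[of _ "[]"]) auto

lemma word_ball_mult:
  assumes "S \<subseteq> carrier G" "g \<in> word_ball G S k" "h \<in> word_ball G S l"
  shows "g \<otimes> h \<in> word_ball G S (k + l)"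
proof -
  obtain xs ys where "g = foldr (\<otimes>) xs \<one>" "set xs \<subseteq> S \<union> set_inv S" "length xs \<le> k"
    "h = foldr (\<otimes>) ys \<one>" "set ys \<subseteq> S \<union> set_inv S" "length ys \<le> l"
    using assms(2,3) unfolding word_ball_def by blast
  moreover from this have "set xs \<subseteq> carrier G" "set ys \<subseteq> carrier G"
    using set_inv_closed[OF assms(1)] by blast+
  ultimately show ?thesis
    unfolding word_ball_def
    using foldr_mult_append[OF is_group, of xs ys]
    by (intro CollectI exI[of _ "xs @ ys"]) simp
qed

lemma word_ball_inv:
  assumes S: "S \<subseteq> carrier G" and g: "g \<in> word_ball G S k"
  shows "inv g \<in> word_ball G S k"
proof -
  obtain xs where xs: "g = foldr (\<otimes>) xs \<one>" "set xs \<subseteq> S \<union> set_inv S" "length xs \<le> k"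
    using g unfolding word_ball_def by blast
  have "inv (foldr (\<otimes>) xs \<one>) \<in> word_ball G S (length xs)"
    using xs(2)
  proof (induction xs)
    case Nil
    show ?case using one_in_word_ball by simp
  next
    case (Cons x xs)
    have x: "x \<in> carrier G" using Cons.prems set_inv_closed[OF S] by auto
    have "inv x \<in> S \<union> set_inv S" using Cons.prems S by (auto simp: SET_INV_def)
    then have inv_x: "inv x \<in> word_ball G S 1"
      unfolding word_ball_def using x by (intro CollectI exI[of _ "[inv x]"]) auto
    have "foldr (\<otimes>) xs \<one> \<in> carrier G"
      using Cons.prems set_inv_closed[OF S] by (intro foldr_mult_closed) auto
    then show ?case
      using word_ball_mult[OF S _ inv_x, of _ "length xs"] Cons x by (simp add: inv_mult_group)
  qed
  then show ?thesis using subsetD[OF word_ball_mono[OF xs(3)]] by (simp add: xs(1))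
qed

lemma generator_in_word_ball: "S \<subseteq> carrier G \<Longrightarrow> g \<in> S \<Longrightarrow> g \<in> word_ball G S 1"
  unfolding word_ball_def by (intro CollectI exI[of _ "[g]"]) auto

lemma r_coset_eq_iff:
  assumes N: "subgroup N G" and g: "g \<in> carrier G" and h: "h \<in> carrier G"
  shows "N #> g = N #> h \<longleftrightarrow> g \<otimes> inv h \<in> N"
proof -
  have "N #> g = N #> h \<longleftrightarrow> g \<in> N #> h"
    using rcos_self[OF g N] repr_independence[OF _ h N] by blast
  then show ?thesis
    using subgroup.rcos_module[OF N is_group h g] by blast
qed

text \<open>A generating set of the quotient is replaced by the union \<open>T\<close> of its members.  As a union of cosets, \<open>T\<close>
also generates the subgroup \<open>N\<close>, hence all of \<open>G\<close>, and words in \<open>T\<close> project to words of the same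
length in the given generating set.\<close>

lemma diam_quotient_le:
  assumes N: "N \<lhd> G" and fin: "finite (carrier (G Mod N))"
    and D: "\<And>T g. T \<subseteq> carrier G \<Longrightarrow> generate G T = carrier G \<Longrightarrow> g \<in> carrier G \<Longrightarrow>
      \<exists>h\<in>word_ball G T D. N #> h = N #> g"
  shows "diam (G Mod N) \<le> D"
proof -
  interpret N: normal N G by fact
  let ?Q = "G Mod N"
  interpret Q: group ?Q by (rule N.factorgroup_is_group)
  interpret h: group_hom G ?Q "\<lambda>g. N #> g"
    by unfold_locales (rule N.r_coset_hom_Mod)
  have sub: "subgroup N G" by (rule N.subgroup_axioms)
  have coset: "X = N #> g" "g \<in> carrier G" if "X \<in> carrier ?Q" "g \<in> X" for X g
  proof -
    obtain x where x: "x \<in> carrier G" "X = N #> x" using \<open>X \<in> _\<close> by (auto simp: carrier_FactGroup)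
    show "X = N #> g" using repr_independence[of g N x] sub x \<open>g \<in> X\<close> by simp
    show "g \<in> carrier G" using x \<open>g \<in> X\<close> N.subset r_coset_subset_G by blast
  qed
  have nonempty: "\<exists>g\<in>X. N #> g = X" if "X \<in> carrier ?Q" for X
    using that rcos_self sub by (auto simp: carrier_FactGroup)
  have "diam_wrt ?Q S \<le> D" if S: "S \<subseteq> carrier ?Q" "generate ?Q S = carrier ?Q" for S
  proof -
    have "carrier ?Q \<subseteq> word_ball ?Q S D"
    proof (cases "S = {}")
      \<comment> \<open>The empty set generates the quotient only if the quotient is trivial, and then \<open>\<Union>S\<close> need not generate \<open>G\<close>.\<close>
      case True
      then have "carrier ?Q = {\<one>\<^bsub>?Q\<^esub>}" using S(2) Q.generate_empty by metis
      then show ?thesis using Q.one_in_word_ball[of S D] by (simp only: insert_subset empty_subsetI simp_thms)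
    next
      case False
      then obtain X0 where X0: "X0 \<in> S" by blast
      then obtain s0 where s0: "s0 \<in> X0" "s0 \<in> carrier G" using nonempty coset S(1) by blast
      let ?T = "\<Union>S"
      have T: "?T \<subseteq> carrier G" using coset(2) S(1) by blast
      have "N \<subseteq> generate G ?T"
      proof
        fix n assume n: "n \<in> N"
        then have nc: "n \<in> carrier G" using N.subset by blast
        have "n \<otimes> s0 \<in> X0" using n coset(1)[of X0 s0] X0 s0 S(1) by (auto simp: r_coset_def)
        then have "n \<otimes> s0 \<otimes> inv s0 \<in> generate G ?T"
          using X0 s0 by (intro generate.eng generate.incl generate.inv) auto
        then show "n \<in> generate G ?T" using nc s0 by (simp add: m_assoc)
      qed
      have lift: "\<exists>h\<in>generate G ?T. N #> h = X" if "X \<in> generate ?Q S" for X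
        using that
      proof induction
        case one
        show ?case using h.hom_one by (intro bexI[of _ \<one>] generate.one) simp
      next
        case (incl X)
        then show ?case using nonempty[of X] S(1) by (blast intro: generate.incl)
      next
        case (inv X)
        then obtain x where x: "x \<in> X" "N #> x = X" using nonempty S(1) by blast
        then have "N #> inv x = inv\<^bsub>?Q\<^esub> X" using h.hom_inv[of x] coset(2) inv S(1) by blast
        moreover have "inv x \<in> generate G ?T" using x inv by (intro generate.inv) blast
        ultimately show ?case by blast
      next
        case (eng X Y)
        then obtain x y where xy: "x \<in> generate G ?T" "N #> x = X" "y \<in> generate G ?T" "N #> y = Y"
          by blast
        then have "N #> (x \<otimes> y) = X \<otimes>\<^bsub>?Q\<^esub> Y"
          using h.hom_mult[of x y] generate_in_carrier[OF T] by blast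
        then show ?case using generate.eng[OF xy(1,3)] by blast
      qed
      have "generate G ?T = carrier G"
      proof
        show "generate G ?T \<subseteq> carrier G" using generate_in_carrier[OF T] by blast
        show "carrier G \<subseteq> generate G ?T"
        proof
          fix g assume g: "g \<in> carrier G"
          then have "N #> g \<in> generate ?Q S" unfolding S(2) by (auto simp: carrier_FactGroup)
          then obtain x where x: "x \<in> generate G ?T" "N #> x = N #> g" using lift by blast
          then have "x \<in> carrier G" using generate_in_carrier[OF T] by blast
          then have "g \<otimes> inv x \<in> N" using r_coset_eq_iff[OF sub g, of x] x(2) by simp
          then have "(g \<otimes> inv x) \<otimes> x \<in> generate G ?T"
            using \<open>N \<subseteq> _\<close> x(1) by (blast intro: generate.eng)
          then show "g \<in> generate G ?T" using g \<open>x \<in> carrier G\<close> by (simp add: m_assoc)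
        qed
      qed
      note D' = D[OF T this]
      show ?thesis
      proof
        fix X assume "X \<in> carrier ?Q"
        then obtain g where "g \<in> carrier G" "X = N #> g" by (auto simp: carrier_FactGroup)
        then obtain h where h: "h \<in> word_ball G ?T D" "X = N #> h" using D' by metis
        then obtain xs where xs: "h = foldr (\<otimes>) xs \<one>" "set xs \<subseteq> ?T \<union> set_inv ?T" "length xs \<le> D"
          unfolding word_ball_def by blast
        have img: "N #> foldr (\<otimes>) xs \<one> = foldr (\<otimes>\<^bsub>?Q\<^esub>) (map (\<lambda>g. N #> g) xs) \<one>\<^bsub>?Q\<^esub>
            \<and> set (map (\<lambda>g. N #> g) xs) \<subseteq> S \<union> set_inv\<^bsub>?Q\<^esub> S"
          using xs(2)
        proof (induction xs)
          case Nil
          show ?case using h.hom_one by simp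
        next
          case (Cons x xs)
          have "set (x # xs) \<subseteq> carrier G" using Cons.prems set_inv_closed[OF T] by blast
          then have "x \<in> carrier G" "foldr (\<otimes>) xs \<one> \<in> carrier G"
            using foldr_mult_closed by auto
          moreover have "N #> x \<in> S \<union> set_inv\<^bsub>?Q\<^esub> S"
          proof (cases "x \<in> ?T")
            case True
            then show ?thesis using coset(1) S(1) by blast
          next
            case False
            then obtain t Y where t: "x = inv t" "t \<in> Y" "Y \<in> S" using Cons.prems by (auto simp: SET_INV_def)
            then have "Y = N #> t" "t \<in> carrier G" using coset S(1) by blast+
            then have "N #> x = inv\<^bsub>?Q\<^esub> Y" using h.hom_inv[of t] t by simp
            then show ?thesis using t(3) by (auto simp: SET_INV_def)
          qed
          ultimately show ?case using Cons h.hom_mult by simp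
        qed
        show "X \<in> word_ball ?Q S D"
          unfolding word_ball_def using img xs h(2)
          by (intro CollectI exI[of _ "map (\<lambda>g. N #> g) xs"]) auto
      qed
    qed
    then have "word_ball ?Q S D = carrier ?Q" using Q.word_ball_subset[OF S(1)] by blast
    then show ?thesis unfolding diam_wrt_def by (rule Least_le)
  qed
  moreover have "finite {diam_wrt ?Q S |S. S \<subseteq> carrier ?Q \<and> generate ?Q S = carrier ?Q}"
    using finite_subset[of _ "diam_wrt ?Q ` Pow (carrier ?Q)"] fin by fastforce
  moreover have "generate ?Q (carrier ?Q) = carrier ?Q"
  proof
    show "generate ?Q (carrier ?Q) \<subseteq> carrier ?Q"
      by (rule subsetI) (rule Q.generate_in_carrier[OF subset_refl])
    show "carrier ?Q \<subseteq> generate ?Q (carrier ?Q)"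
      by (rule subsetI) (rule generate.incl)
  qed
  ultimately show ?thesis
    unfolding diam_def by (intro Max.boundedI) auto
qed

end

section \<open>Short words, index and the diameter bounds\<close>

context odd_prime
begin

context
  fixes T assumes T: "T \<subseteq> carrier (gupta_sidki p)" and gen: "generate (gupta_sidki p) T = carrier (gupta_sidki p)"
begin

definition reach :: "nat \<Rightarrow> word \<Rightarrow> bool" where
  "reach l w \<longleftrightarrow> evalw w \<in> word_ball (gupta_sidki p) T l"

lemma word_cost_reach: "word_cost reach"
proof -
  interpret group "gupta_sidki p" by (rule group_gupta_sidki[OF p_pos])
  show ?thesis
    unfolding word_cost_def reach_def
  proof (intro conjI allI impI)
    show "evalw [] \<in> word_ball (gupta_sidki p) T 0"
      using one_in_word_ball by (simp add: one_gupta_sidki)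
    show "evalw w \<in> word_ball (gupta_sidki p) T l"
      if "evalw w \<in> word_ball (gupta_sidki p) T k" "k \<le> l" for k l w
      using that(1) word_ball_mono[OF that(2)] by (rule subsetD[rotated])
    show "evalw (u @ w) \<in> word_ball (gupta_sidki p) T (k + l)"
      if "evalw u \<in> word_ball (gupta_sidki p) T k" "evalw w \<in> word_ball (gupta_sidki p) T l" for k l u w
      using word_ball_mult[OF T that] by (simp add: mult_gupta_sidki)
    show "evalw (winv w) \<in> word_ball (gupta_sidki p) T k"
      if "evalw w \<in> word_ball (gupta_sidki p) T k" for k w
      using word_ball_inv[OF T that] by (simp add: inv_gupta_sidki)
  qed
qed

lemma reach_generator: "evalw w \<in> T \<Longrightarrow> reach 1 w"
  using group.generator_in_word_ball[OF group_gupta_sidki[OF p_pos] T] by (simp add: reach_def)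

text \<open>A linear form in the exponents is a homomorphism on the group; if it vanished on a generating set it would
vanish on \<open>a\<close> and on \<open>b\<close>.\<close>

lemma ex_generator_nonvanishing:
  assumes "\<not> (int p dvd c \<and> int p dvd d)"
  shows "\<exists>w. evalw w \<in> T \<and> \<not> int p dvd c * exp_a w + d * exp_b w"
proof (rule ccontr)
  assume "\<not> ?thesis"
  then have van: "int p dvd c * exp_a w + d * exp_b w" if "evalw w \<in> T" for w
    using that by blast
  have transfer: "int p dvd c * exp_a u + d * exp_b u"
    if "evalw u = evalw w" "int p dvd c * exp_a w + d * exp_b w" for u w
  proof -
    have "[c * exp_a u + d * exp_b u = c * exp_a w + d * exp_b w] (mod int p)"
      using evalw_eq_imp_exponents[OF that(1)] by (intro cong_add cong_mult cong_refl)
    then show ?thesis using that(2) cong_dvd_iff by blast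
  qed
  have "\<forall>w. evalw w = g \<longrightarrow> int p dvd c * exp_a w + d * exp_b w"
    if "g \<in> generate (gupta_sidki p) T" for g
    using that
  proof induction
    case one
    show ?case using transfer[of _ "[]"] by (simp add: one_gupta_sidki)
  next
    case (incl h)
    then show ?case using van by blast
  next
    case (inv h)
    then obtain u where u: "h = evalw u" using T by (auto simp: carrier_gupta_sidki)
    have "int p dvd - (c * exp_a u + d * exp_b u)" using van[of u] inv u by (simp only: dvd_minus_iff)
    then show ?case using transfer[of _ "winv u"] by (simp add: u inv_gupta_sidki algebra_simps)
  next
    case (eng h1 h2)
    then have "h1 \<in> range evalw" "h2 \<in> range evalw" using gen carrier_gupta_sidki by auto
    then obtain u1 u2 where u: "h1 = evalw u1" "h2 = evalw u2" by blast
    then have "int p dvd (c * exp_a u1 + d * exp_b u1) + (c * exp_a u2 + d * exp_b u2)"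
      using eng.IH by (blast intro: dvd_add[of "int p" "c * exp_a u1 + d * exp_b u1"])
    then show ?case using transfer[of _ "u1 @ u2"] by (simp add: u mult_gupta_sidki algebra_simps)
  qed
  then have "int p dvd c * exp_a w + d * exp_b w" for w
    unfolding gen carrier_gupta_sidki by blast
  from this[of "[A True]"] this[of "[B True]"] assms show False by simp
qed

text \<open>Two generators with linearly independent exponent vectors exist, and Cramer's rule modulo \<open>p\<close>
expresses any prescribed exponents by powers of them.\<close>

lemma ex_short_word_with_exponents:
  "\<exists>w. reach (2 * p) w \<and> [exp_a w = P] (mod int p) \<and> [exp_b w = Q] (mod int p)"
proof -
  have "\<not> int p dvd 1" using p_ge_3 by auto
  then obtain s where s: "evalw s \<in> T" "\<not> int p dvd exp_a s"
    using ex_generator_nonvanishing[of 1 0] by auto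
  then obtain t where t: "evalw t \<in> T" "\<not> int p dvd - exp_b s * exp_a t + exp_a s * exp_b t"
    using ex_generator_nonvanishing[of "- exp_b s" "exp_a s"] by blast
  define D where "D = - exp_b s * exp_a t + exp_a s * exp_b t"
  have "prime (int p)" using prime by simp
  then have "coprime D (int p)"
    using t(2) by (simp add: D_def coprime_commute prime_imp_coprime)
  then obtain k where k: "[D * k = 1] (mod int p)" using cong_solve_coprime_int by blast
  define i where "i = nat (k * (P * exp_b t - Q * exp_a t) mod int p)"
  define j where "j = nat (k * (Q * exp_a s - P * exp_b s) mod int p)"
  have ij: "[int i = k * (P * exp_b t - Q * exp_a t)] (mod int p)"
    "[int j = k * (Q * exp_a s - P * exp_b s)] (mod int p)" "i \<le> p" "j \<le> p"
    using p_pos by (auto simp: i_def j_def cong_def nat_le_iff intro!: less_imp_le)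
  let ?w = "wpow s i @ wpow t j"
  have "reach (i * 1 + j * 1) ?w"
    by (intro cost_append[OF word_cost_reach] cost_wpow[OF word_cost_reach] reach_generator s t)
  then have "reach (2 * p) ?w" by (rule cost_mono[OF word_cost_reach]) (use ij in simp)
  moreover have "[exp_a ?w = P] (mod int p)"
  proof -
    have "[int i * exp_a s + int j * exp_a t = k * (P * exp_b t - Q * exp_a t) * exp_a s
        + k * (Q * exp_a s - P * exp_b s) * exp_a t] (mod int p)"
      by (intro cong_add cong_mult cong_refl ij)
    also have "k * (P * exp_b t - Q * exp_a t) * exp_a s
        + k * (Q * exp_a s - P * exp_b s) * exp_a t = D * k * P"
      by (simp add: D_def algebra_simps)
    also have "[D * k * P = 1 * P] (mod int p)" by (intro cong_mult cong_refl k)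
    finally show ?thesis by simp
  qed
  moreover have "[exp_b ?w = Q] (mod int p)"
  proof -
    have "[int i * exp_b s + int j * exp_b t = k * (P * exp_b t - Q * exp_a t) * exp_b s
        + k * (Q * exp_a s - P * exp_b s) * exp_b t] (mod int p)"
      by (intro cong_add cong_mult cong_refl ij)
    also have "k * (P * exp_b t - Q * exp_a t) * exp_b s
        + k * (Q * exp_a s - P * exp_b s) * exp_b t = D * k * Q"
      by (simp add: D_def algebra_simps)
    also have "[D * k * Q = 1 * Q] (mod int p)" by (intro cong_mult cong_refl k)
    finally show ?thesis by simp
  qed
  ultimately show ?thesis by blast
qed

lemma ex_short_representative:
  assumes g: "g \<in> carrier (gupta_sidki p)"
  shows "\<exists>h\<in>word_ball (gupta_sidki p) T (2 * p + (\<Sum>m<n. 2 * p ^ (m + 3) * ((p ^ 3 + p) ^ m * (8 * p)))).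
    gs_stab p n #>\<^bsub>gupta_sidki p\<^esub> h = gs_stab p n #>\<^bsub>gupta_sidki p\<^esub> g"
proof -
  interpret group "gupta_sidki p" by (rule group_gupta_sidki[OF p_pos])
  interpret N: normal "gs_stab p n" "gupta_sidki p" by (rule normal_gs_stab[OF p_pos])
  note R = word_cost_reach
  obtain x where x: "reach (2 * p) x" "[exp_a x = 1] (mod int p)"
    using ex_short_word_with_exponents[of 1 0] by blast
  obtain y where y: "reach (2 * p) y" "[exp_a y = 0] (mod int p)" "[exp_b y = 1] (mod int p)"
    using ex_short_word_with_exponents[of 0 1] by blast
  have F: "frame reach (8 * p) 0 x y (\<lambda>_. wcomm x y)"
  proof (rule frame_0)
    show "reach (8 * p) x" "reach (8 * p) y" using x y by (auto intro: cost_mono[OF R])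
    show "reach (8 * p) (wcomm x y)" using cost_wcomm[OF R x(1) y(1)] by simp
  qed (use x y in \<open>auto simp: cong_0_iff\<close>)
  obtain w where w: "g = evalw w" using g by (auto simp: carrier_gupta_sidki)
  obtain u0 where u0: "reach (2 * p) u0" "[exp_a u0 = exp_a w] (mod int p)" "[exp_b u0 = exp_b w] (mod int p)"
    using ex_short_word_with_exponents by blast
  have "level_derived 0 (winv u0 @ w)"
    using u0(2,3) by (simp add: level_derived_def cong_iff_dvd_diff dvd_diff_commute)
  from approximate_by_frames[OF R F this, of n] obtain u where
    u: "reach (\<Sum>m<n. 2 * p ^ (m + 3) * ((p ^ 3 + p) ^ m * (8 * p))) u" "level_derived n (winv u @ winv u0 @ w)"
    by blast
  define h where "h = u0 @ u"
  have "wstab n (winv h @ w)" using level_derivedD(1)[OF u(2)] by (simp add: h_def)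
  then have "evalw (winv h @ w) \<in> gs_stab p n" by (simp add: evalw_in_gs_stab)
  then have "evalw h \<otimes>\<^bsub>gupta_sidki p\<^esub> evalw (winv h @ w) \<otimes>\<^bsub>gupta_sidki p\<^esub> inv\<^bsub>gupta_sidki p\<^esub> evalw h \<in> gs_stab p n"
    by (intro N.inv_op_closed2) (auto simp: carrier_gupta_sidki)
  moreover have carr: "evalw v \<in> carrier (gupta_sidki p)" for v by (simp add: carrier_gupta_sidki)
  ultimately have "evalw w \<otimes>\<^bsub>gupta_sidki p\<^esub> inv\<^bsub>gupta_sidki p\<^esub> evalw h \<in> gs_stab p n"
    by (simp add: mult_gupta_sidki[symmetric] inv_gupta_sidki[symmetric] m_assoc[symmetric])
  then have "gs_stab p n #>\<^bsub>gupta_sidki p\<^esub> evalw h = gs_stab p n #>\<^bsub>gupta_sidki p\<^esub> g"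
    unfolding w using r_coset_eq_iff[OF N.subgroup_axioms carr carr, of w h] by simp
  moreover have "reach (2 * p + (\<Sum>m<n. 2 * p ^ (m + 3) * ((p ^ 3 + p) ^ m * (8 * p)))) h"
    unfolding h_def by (rule cost_append[OF R u0(1) u(1)])
  ultimately show ?thesis unfolding reach_def by blast
qed

end

lemma geometric_bound: "q \<ge> 2 \<Longrightarrow> (\<Sum>m<n. q ^ m) \<le> (q::nat) ^ n"
proof (induction n)
  case (Suc n)
  then have "(\<Sum>m<Suc n. q ^ m) \<le> 2 * q ^ n" by simp
  also have "\<dots> \<le> q ^ Suc n" using Suc.prems by simp
  finally show ?case .
qed simp

lemma diam_le:
  "diam (gupta_sidki p Mod gs_stab p n) \<le> (2 * p + 16 * p ^ 4) * (p ^ 4 + p ^ 2) ^ n"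
proof -
  let ?q = "p ^ 4 + p ^ 2"
  let ?D = "2 * p + (\<Sum>m<n. 2 * p ^ (m + 3) * ((p ^ 3 + p) ^ m * (8 * p)))"
  have "diam (gupta_sidki p Mod gs_stab p n) \<le> ?D"
    by (rule group.diam_quotient_le[OF group_gupta_sidki normal_gs_stab finite_quotient_gs_stab])
      (use p_pos ex_short_representative in auto)
  also have "(\<Sum>m<n. 2 * p ^ (m + 3) * ((p ^ 3 + p) ^ m * (8 * p))) = 16 * p ^ 4 * (\<Sum>m<n. ?q ^ m)"
  proof -
    have "2 * p ^ (m + 3) * ((p ^ 3 + p) ^ m * (8 * p)) = 16 * p ^ 4 * ?q ^ m" for m
    proof -
      have p4: "p ^ 4 = p * p ^ 3" using power_Suc[of p 3] by simp
      have "?q = p * (p ^ 3 + p)" by (simp add: p4 distrib_left power2_eq_square)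
      then have "?q ^ m = p ^ m * (p ^ 3 + p) ^ m" by (simp only: power_mult_distrib)
      then show ?thesis by (simp add: power_add p4)
    qed
    then show ?thesis unfolding sum_distrib_left by (rule sum.cong[OF refl])
  qed
  also have "2 * p + 16 * p ^ 4 * (\<Sum>m<n. ?q ^ m) \<le> 2 * p * ?q ^ n + 16 * p ^ 4 * ?q ^ n"
  proof (intro add_mono mult_left_mono geometric_bound)
    have "2 \<le> p ^ 2" using p_ge_3 power_mono[of 3 p 2] by simp
    then show "2 \<le> ?q" by simp
    have "1 \<le> ?q ^ n" using p_pos by (intro one_le_power) (simp add: Suc_le_eq)
    then show "2 * p \<le> 2 * p * ?q ^ n" by simp
  qed auto
  finally show ?thesis by (simp add: algebra_simps)
qed

lemma card_rcosets_ge: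
  assumes fin: "finite X"
    and inj: "\<And>a b. a \<in> X \<Longrightarrow> b \<in> X \<Longrightarrow> wstab n (u a @ winv (u b)) \<Longrightarrow> a = b"
  shows "card X \<le> card (rcosets\<^bsub>gupta_sidki p\<^esub> (gs_stab p n))"
proof -
  interpret group "gupta_sidki p" by (rule group_gupta_sidki[OF p_pos])
  interpret N: normal "gs_stab p n" "gupta_sidki p" by (rule normal_gs_stab[OF p_pos])
  have carr: "evalw v \<in> carrier (gupta_sidki p)" for v by (simp add: carrier_gupta_sidki)
  let ?f = "\<lambda>a. gs_stab p n #>\<^bsub>gupta_sidki p\<^esub> evalw (u a)"
  have "inj_on ?f X"
  proof (rule inj_onI)
    fix a b assume ab: "a \<in> X" "b \<in> X" "?f a = ?f b"
    then have "evalw (u a) \<otimes>\<^bsub>gupta_sidki p\<^esub> inv\<^bsub>gupta_sidki p\<^esub> evalw (u b) \<in> gs_stab p n"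
      using r_coset_eq_iff[OF N.subgroup_axioms carr carr] by blast
    then have "wstab n (u a @ winv (u b))"
      by (simp add: inv_gupta_sidki mult_gupta_sidki evalw_in_gs_stab)
    then show "a = b" using inj ab by blast
  qed
  moreover have "?f ` X \<subseteq> rcosets\<^bsub>gupta_sidki p\<^esub> (gs_stab p n)"
    using rcosetsI[OF N.subset carr] by blast
  moreover have "finite (rcosets\<^bsub>gupta_sidki p\<^esub> (gs_stab p n))"
    using finite_quotient_gs_stab[OF p_pos] by (simp add: FactGroup_def)
  ultimately show ?thesis using card_inj_on_le by blast
qed

lemma small_cong_imp_eq: "[int i = int j] (mod int p) \<Longrightarrow> i < p \<Longrightarrow> j < p \<Longrightarrow> i = j"
  by (simp add: cong_def)

text \<open>Every function from the vertices of level \<open>m = n - 2\<close> to \<open>\<int>/p\<close> is the \<open>exp_c\<close> vector of a word with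
derived sections, and words in the same coset have the same vector.  On the first level the powers of
\<open>a\<close> give \<open>p\<close> cosets, in agreement with the truncated subtraction in the exponent.\<close>

lemma card_rcosets_lower:
  assumes n: "n \<ge> 1"
  shows "p ^ (p ^ (n - 2)) \<le> card (rcosets\<^bsub>gupta_sidki p\<^esub> (gs_stab p n))"
proof (cases "n = 1")
  case True
  have "card {..<p} \<le> card (rcosets\<^bsub>gupta_sidki p\<^esub> (gs_stab p n))"
  proof (rule card_rcosets_ge)
    fix i j assume ij: "i \<in> {..<p}" "j \<in> {..<p}" "wstab n (wpow [A True] i @ winv (wpow [A True] j))"
    then have "[int i = int j] (mod int p)" using True by (simp add: cong_iff_dvd_diff)
    then show "i = j" using ij small_cong_imp_eq by simp
  qed simp
  then show ?thesis using True by simp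
next
  case False
  define m where "m = n - 2"
  have nm: "n = m + 2" using n False by (simp add: m_def)
  let ?V = "level_words p m"
  have R: "word_cost (\<lambda>_ _. True)" by (simp add: word_cost_def)
  have "frame (\<lambda>_ _. True) 0 0 [A True] [B True] (\<lambda>_. wcomm [A True] [B True])"
    by (rule frame_0) auto
  from ex_frame[OF R this, of m] obtain L x y z where F: "frame (\<lambda>_ _. True) L m x y z" by blast
  from independent_words[OF F] obtain u where
    u: "\<And>\<phi>. level_derived m (u \<phi>)" "\<And>\<phi> v. v \<in> ?V \<Longrightarrow> [exp_c (vsection v (u \<phi>)) = \<phi> v] (mod int p)"
    by metis
  let ?X = "?V \<rightarrow>\<^sub>E {..<p}"
  have "card ?X \<le> card (rcosets\<^bsub>gupta_sidki p\<^esub> (gs_stab p n))"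
  proof (rule card_rcosets_ge[where u = "\<lambda>\<phi>. u (\<lambda>v. int (\<phi> v))"])
    show "finite ?X" by (intro finite_PiE) auto
    fix \<phi> \<psi> assume ps: "\<phi> \<in> ?X" "\<psi> \<in> ?X"
      and st: "wstab n (u (\<lambda>v. int (\<phi> v)) @ winv (u (\<lambda>v. int (\<psi> v))))"
    show "\<phi> = \<psi>"
    proof (rule PiE_ext[OF ps])
      fix v assume v: "v \<in> ?V"
      let ?P = "vsection v (u (\<lambda>v. int (\<phi> v)))" and ?Q = "vsection v (u (\<lambda>v. int (\<psi> v)))"
      note dP = level_derivedD[OF u(1)[of "\<lambda>v. int (\<phi> v)"]] and dQ = level_derivedD[OF u(1)[of "\<lambda>v. int (\<psi> v)"]]
      have "vsection v (u (\<lambda>v. int (\<phi> v)) @ winv (u (\<lambda>v. int (\<psi> v)))) = ?P @ winv ?Q"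
        using vsection_append[OF wstab_winv[OF dQ(1)] v] vsection_winv[OF dQ(1) v] by simp
      moreover have "wstab 2 (vsection v (u (\<lambda>v. int (\<phi> v)) @ winv (u (\<lambda>v. int (\<psi> v)))))"
        using wstab_vsection[OF _ v] st nm by simp
      ultimately have "int p dvd exp_c (?P @ winv ?Q)" using wstab_2_trivial_exponents(3) by metis
      then have "int p dvd (exp_c ?P - exp_c ?Q) + (exp_a ?Q - exp_a ?P) * exp_b ?Q"
        by (simp add: algebra_simps)
      then have "int p dvd exp_c ?P - exp_c ?Q"
        using dQ(3)[OF v] by (simp add: dvd_add_left_iff)
      then have "[exp_c ?P = exp_c ?Q] (mod int p)" by (simp add: cong_iff_dvd_diff)
      then have "[int (\<phi> v) = int (\<psi> v)] (mod int p)"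
        using u(2)[OF v, of "\<lambda>v. int (\<phi> v)"] u(2)[OF v, of "\<lambda>v. int (\<psi> v)"]
        by (simp add: cong_def)
      then show "\<phi> v = \<psi> v" using small_cong_imp_eq ps v by (auto simp: PiE_iff)
    qed
  qed
  moreover have "card ?X = p ^ (p ^ m)"
    by (simp add: card_PiE card_level_words)
  ultimately show ?thesis by (simp add: m_def)
qed

text \<open>With \<open>p + 8 \<le> (11/8) 2\<^sup>p\<close> the constant is at least \<open>(13/8) 4\<^sup>p + 7\<close>; both auxiliary inequalities hold
from \<open>3\<close> onwards by induction.\<close>

lemma gs_const_ge: "real (p ^ 4 + p ^ 2) \<le> gs_const p"
proof -
  have "8 * (k + 8) \<le> 11 * 2 ^ k" if "k \<ge> 3" for k :: nat
    using that by (induction k rule: nat_induct_at_least) auto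
  then have "8 * (p + 8) \<le> 11 * 2 ^ p" using p_ge_3 .
  then have "real (8 * (p + 8)) \<le> real (11 * 2 ^ p)" by (simp only: of_nat_le_iff)
  then have "8 * (real p + 8) \<le> 11 * 2 ^ p" by simp
  then have "2 ^ p * (8 * (real p + 8)) \<le> 2 ^ p * (11 * 2 ^ p)" by (intro mult_left_mono) auto
  moreover have "(4::real) ^ p = 2 ^ p * 2 ^ p" by (simp add: power_mult_distrib[symmetric])
  ultimately have 1: "8 * (2 ^ p * (real p + 8)) \<le> 11 * 4 ^ p" by (simp add: algebra_simps)
  have "8 * (k ^ 4 + k ^ 2) \<le> 13 * 4 ^ k + 56" if "k \<ge> 3" for k :: nat
    using that
  proof (induction k rule: nat_induct_at_least)
    case (Suc k)
    obtain d where d: "k = 3 + d" using Suc.hyps le_Suc_ex by blast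
    have "Suc k ^ 4 + Suc k ^ 2 + 21 \<le> 4 * (k ^ 4 + k ^ 2)"
      unfolding d by (simp add: power4_eq_xxxx power2_eq_square algebra_simps)
    then show ?case using Suc.IH by simp
  qed simp
  then have "8 * (p ^ 4 + p ^ 2) \<le> 13 * 4 ^ p + 56" using p_ge_3 .
  then have "real (8 * (p ^ 4 + p ^ 2)) \<le> real (13 * 4 ^ p + 56)" by (simp only: of_nat_le_iff)
  then have 2: "8 * real (p ^ 4 + p ^ 2) \<le> 13 * 4 ^ p + 56" by simp
  have "x \<le> 3 * c - y + 7" if "8 * y \<le> 11 * c" "8 * x \<le> 13 * c + 56" for x y c :: real
    using that by linarith
  from this[OF 1 2] show ?thesis unfolding gs_const_def .
qed

lemma diam_bound:
  obtains K where "K \<ge> 0" "\<And>n. real (diam (gupta_sidki p Mod gs_stab p n)) \<le> K * gs_const p ^ n"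
proof
  let ?K = "real (2 * p + 16 * p ^ 4)"
  show "?K \<ge> 0" by simp
  fix n
  have "real (diam (gupta_sidki p Mod gs_stab p n)) \<le> real ((2 * p + 16 * p ^ 4) * (p ^ 4 + p ^ 2) ^ n)"
    using diam_le by (simp only: of_nat_le_iff)
  also have "\<dots> = ?K * real (p ^ 4 + p ^ 2) ^ n" by simp
  also have "\<dots> \<le> ?K * gs_const p ^ n"
    by (intro mult_left_mono power_mono gs_const_ge) auto
  finally show "real (diam (gupta_sidki p Mod gs_stab p n)) \<le> ?K * gs_const p ^ n" .
qed

end

theorem theorem1p3:
  fixes p :: nat
  assumes "prime p" and "odd p"
  shows "(\<exists>K::real. \<forall>n\<ge>1::nat.
            real (diam (gupta_sidki p Mod gs_stab p n)) \<le> K * exp (ln (gs_const p) * real n))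
       \<and> (\<exists>K::real. \<forall>n\<ge>1::nat.
            real (diam (gupta_sidki p Mod gs_stab p n))
              \<le> K * ln (real (card (rcosets\<^bsub>gupta_sidki p\<^esub> (gs_stab p n))))
                      powr (ln (gs_const p) / ln (real p)))"
proof -
  interpret odd_prime p by unfold_locales (fact assms)+
  obtain K where K: "K \<ge> 0" "\<And>n. real (diam (gupta_sidki p Mod gs_stab p n)) \<le> K * gs_const p ^ n"
    using diam_bound by blast
  let ?C = "gs_const p"
  have "real (p ^ 4 + p ^ 2) \<ge> 1" using p_pos by (simp add: add_increasing2)
  then have C: "?C \<ge> 1" using gs_const_ge by linarith
  have lnp: "ln (real p) > 0" using p_ge_3 by simp
  define e where "e = ln ?C / ln (real p)"
  have e: "e \<ge> 0" using C lnp by (simp add: e_def)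
  have C_pow: "exp (ln ?C * real n) = ?C ^ n" for n
    using C by (simp add: mult.commute exp_of_nat_mult)
  have p_powr: "real p powr e = ?C"
    using C lnp p_pos by (simp add: powr_def e_def)
  have "real (diam (gupta_sidki p Mod gs_stab p n)) \<le> K * exp (ln ?C * real n)" for n
    using K(2) by (simp only: C_pow)
  moreover have "real (diam (gupta_sidki p Mod gs_stab p n))
      \<le> (K * ?C ^ 2 / ln (real p) powr e) * ln (real (card (rcosets\<^bsub>gupta_sidki p\<^esub> (gs_stab p n)))) powr e"
    if n: "n \<ge> 1" for n
  proof -
    let ?I = "card (rcosets\<^bsub>gupta_sidki p\<^esub> (gs_stab p n))"
    have "real (p ^ (p ^ (n - 2))) \<le> real ?I"
      using card_rcosets_lower[OF n] by (simp only: of_nat_le_iff)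
    moreover have "real (p ^ (p ^ (n - 2))) > 0" using p_pos by simp
    ultimately have "ln (real (p ^ (p ^ (n - 2)))) \<le> ln (real ?I)" by (rule ln_mono)
    then have "real p ^ (n - 2) * ln (real p) \<le> ln (real ?I)"
      using p_pos by (simp add: ln_realpow)
    then have "(real p ^ (n - 2) * ln (real p)) powr e \<le> ln (real ?I) powr e"
      using lnp e by (intro powr_mono2) auto
    moreover have "(real p ^ (n - 2) * ln (real p)) powr e = ?C ^ (n - 2) * ln (real p) powr e"
    proof -
      have "(real p ^ (n - 2)) powr e = (real p powr e) ^ (n - 2)"
        using p_pos by (simp add: powr_realpow[symmetric] powr_powr powr_power mult.commute)
      then show ?thesis using lnp p_pos by (simp add: powr_mult p_powr)
    qed
    ultimately have I: "?C ^ (n - 2) * ln (real p) powr e \<le> ln (real ?I) powr e" by simp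
    have "K * ?C ^ n \<le> K * ?C ^ (2 + (n - 2))"
      using C K(1) by (intro mult_left_mono power_increasing) auto
    also have "\<dots> = (K * ?C ^ 2 / ln (real p) powr e) * (?C ^ (n - 2) * ln (real p) powr e)"
      using lnp by (simp add: power_add power2_eq_square)
    also have "\<dots> \<le> (K * ?C ^ 2 / ln (real p) powr e) * ln (real ?I) powr e"
      using I K(1) C by (intro mult_left_mono) auto
    finally show ?thesis using K(2)[of n] by linarith
  qed
  ultimately show ?thesis unfolding e_def by blast
qed

end
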